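(* Consider the flat periodic model described in the context, with fixed tangential period $L=Mh$, and let $\widetilde K_{\rm red}^{S}$ and $\widetilde K_{\rm red}^{D}$ be the density stiffness matrices of the single- and double-layer parametrizations, considered on the nonzero Fourier subspace. Their (nonzero) eigenvalues satisfy $$\lambda_{\min}^+(\widetilde K_{\rm red}^{S})\simeq\lambda_{\max}(\widetilde K_{\rm red}^{S})\simeq h^{-1},\qquad\lambda_{\min}^+(\widetilde K_{\rm red}^{D})\simeq h,\quad\lambda_{\max}(\widetilde K_{\rm red}^{D})\simeq h^{-1}.$$ Consequently $$\kappa^+(\widetilde K_{\rm red}^{S})\lesssim1,\qquad\kappa^+(\widetilde K_{\rm red}^{D})\lesssim h^{-2},$$ where $\kappa^+$ is the condition number (ratio of largest to smallest eigenvalue) on the nonzero Fourier subspace. All constants are uniform in $h$ and in the cut offset of the flat interface.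
   Context: $a\simeq b$ means $c^{-1}b\le a\le cb$, and $a\lesssim b$ means $a\le cb$, with constants $c>0$ as specified in the claim. **Flat periodic model.** Nodes are indexed by a tangential index $m\in\mathbb Z_M=\mathbb Z/M\mathbb Z$ and a layer index $j\in\mathbb Z$, with grid spacing $h$ in both directions and $Mh=L$ fixed. The layer $j=0$ is $\gamma_2$; $j\ge0$ counts layers into the harmonic side, $j<0$ is exterior. Discrete Fourier transform: $\widehat v(\theta)=\sum_{m\in\mathbb Z_M}v_me^{-im\theta}$, $\theta\in\Theta_M=\{2\pi k/M:k\in\mathbb Z_M\}$ represented in $[-\pi,\pi)$. The nonzero Fourier subspace is $\{q\in\mathbb R^M:\sum_mq_m=0\}$. *Harmonic extension and trace.* For data $V\in\mathbb R^{M}$ on $\gamma_2$, let $U$ be its bounded five-point discrete harmonic extension to $j\ge0$: $\widehat U_j(\theta)=e^{-j\alpha(\theta)}\widehat V(\theta)$ with $\alpha(\theta)\ge0$, $\cosh\alpha(\theta)=2-\cos\theta$. The flat interface $\Gamma^h$ is the periodic line at height $(d+\rho)h$, with integer $0\le d\le D$ ($D$ fixed) and $0\le\rho\le1$ (the cut offset is $(d,\rho)$). The trace of the reconstruction of $V$ is the periodic continuous piecewise linear function $w_V$ on $\Gamma^h$ (uniform nodes at spacing $h$) with nodal values $(1-\rho)U_{d,m}+\rho U_{d+1,m}$. *Layer operators.* For $q\in\mathbb R^M$ with $\sum_m q_m=0$ and a source row $k$, let $z^{(k)}[q]$ be the function on $\mathbb Z_M\times\mathbb Z$ tending to $0$ as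 $|j|\to\infty$ with $4z(m,j)-\sum_{\text{4 neighbours}}z=q_m$ if $j=k$ and $=0$ otherwise (this is the lattice Green's function potential for the scaled source convention $-L_hG_h=\delta_0$, $\delta_0(0)=h^{-2}$). The single-layer trace operator is $(Sq)_m=z^{(0)}[q](m,0)$; the double-layer trace operator is $(Dq)_m=z^{(-1)}[q](m,0)-z^{(0)}[q](m,0)$ (each source has one exterior normal neighbour, in row $-1$). *Density stiffness.* With $P_2=S$ or $P_2=D$, $\widetilde K_{\rm red}^{S}$, resp. $\widetilde K_{\rm red}^{D}$, is the symmetric operator on the nonzero Fourier subspace given by $q^T\widetilde K_{\rm red}q=\|\partial_sw_{P_2q}\|_{L^2(\Gamma^h)}^2$, where $\partial_s$ is the tangential derivative along $\Gamma^h$. *)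

theory Defs
  imports "HOL-Analysis.Analysis"
begin

text \<open>
  A vector indexed by the integers modulo \<open>M\<close> is represented by an \<open>M\<close>-periodic function on the
  integers, so that the tangential neighbours of \<open>m\<close> are simply \<open>m + 1\<close> and \<open>m - 1\<close>.
  All definitions below are meant for \<open>M > 0\<close>.
\<close>

definition grid_vectors :: "nat \<Rightarrow> (int \<Rightarrow> real) set" where
  "grid_vectors M = {v. \<forall>m. v (m + int M) = v m}"

definition grid_inner :: "nat \<Rightarrow> (int \<Rightarrow> real) \<Rightarrow> (int \<Rightarrow> real) \<Rightarrow> real" where
  "grid_inner M u v = (\<Sum>m<M. u (int m) * v (int m))"

definition nonzero_fourier :: "nat \<Rightarrow> (int \<Rightarrow> real) set" where
  "nonzero_fourier M = {q \<in> grid_vectors M. (\<Sum>m<M. q (int m)) = 0}"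

text \<open>
  The value \<open>U m j\<close> belongs to tangential index \<open>m\<close> and layer \<open>j \<ge> 0\<close>. The five-point equation is
  imposed in the layers \<open>j \<ge> 1\<close>, and boundedness makes the extension unique; its discrete Fourier
  transform in \<open>m\<close> is \<open>exp (- j * \<alpha>(\<theta>))\<close> times that of the data, with \<open>\<alpha>(\<theta>) \<ge> 0\<close> and
  \<open>cosh (\<alpha>(\<theta>)) = 2 - cos \<theta>\<close>.
\<close>

definition is_harmonic_extension ::
    "nat \<Rightarrow> (int \<Rightarrow> real) \<Rightarrow> (int \<Rightarrow> nat \<Rightarrow> real) \<Rightarrow> bool" where
  "is_harmonic_extension M V U \<longleftrightarrow>
     (\<forall>j. (\<lambda>m. U m j) \<in> grid_vectors M) \<and>
     (\<forall>m. U m 0 = V m) \<and>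
     (\<forall>m. \<forall>j\<ge>1. 4 * U m j - (U (m + 1) j + U (m - 1) j + U m (j + 1) + U m (j - 1)) = 0) \<and>
     bounded (range (\<lambda>(m, j). U m j))"

definition harmonic_extension :: "nat \<Rightarrow> (int \<Rightarrow> real) \<Rightarrow> int \<Rightarrow> nat \<Rightarrow> real" where
  "harmonic_extension M V = (THE U. is_harmonic_extension M V U)"

definition trace_values ::
    "nat \<Rightarrow> nat \<Rightarrow> real \<Rightarrow> (int \<Rightarrow> real) \<Rightarrow> int \<Rightarrow> real" where
  "trace_values M d \<rho> V m =
     (1 - \<rho>) * harmonic_extension M V m d + \<rho> * harmonic_extension M V m (d + 1)"

definition pw_linear :: "real \<Rightarrow> (int \<Rightarrow> real) \<Rightarrow> real \<Rightarrow> real" where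
  "pw_linear h f s = (1 - frac (s / h)) * f \<lfloor>s / h\<rfloor> + frac (s / h) * f (\<lfloor>s / h\<rfloor> + 1)"

text \<open>
  The interface at height \<open>(d + \<rho>) * h\<close> is parametrized by its tangential coordinate \<open>s\<close>, one period
  being \<open>0 \<le> s \<le> M * h\<close>. The derivative is unspecified at the finitely many nodes only.
\<close>

definition trace_function ::
    "nat \<Rightarrow> real \<Rightarrow> nat \<Rightarrow> real \<Rightarrow> (int \<Rightarrow> real) \<Rightarrow> real \<Rightarrow> real" where
  "trace_function M h d \<rho> V = pw_linear h (trace_values M d \<rho> V)"

definition trace_energy ::
    "nat \<Rightarrow> real \<Rightarrow> nat \<Rightarrow> real \<Rightarrow> (int \<Rightarrow> real) \<Rightarrow> real" where
  "trace_energy M h d \<rho> V =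
     integral {0..real M * h} (\<lambda>s. (deriv (trace_function M h d \<rho> V) s)\<^sup>2)"

definition is_layer_potential ::
    "nat \<Rightarrow> int \<Rightarrow> (int \<Rightarrow> real) \<Rightarrow> (int \<Rightarrow> int \<Rightarrow> real) \<Rightarrow> bool" where
  "is_layer_potential M k q z \<longleftrightarrow>
     (\<forall>j. (\<lambda>m. z m j) \<in> grid_vectors M) \<and>
     (\<forall>m. (z m \<longlongrightarrow> 0) at_top \<and> (z m \<longlongrightarrow> 0) at_bot) \<and>
     (\<forall>m j. 4 * z m j - (z (m + 1) j + z (m - 1) j + z m (j + 1) + z m (j - 1))
              = (if j = k then q m else 0))"

text \<open>For \<open>q\<close> in \<open>nonzero_fourier M\<close> there is exactly one such potential.\<close>

definition layer_potential :: "nat \<Rightarrow> int \<Rightarrow> (int \<Rightarrow> real) \<Rightarrow> int \<Rightarrow> int \<Rightarrow> real" where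
  "layer_potential M k q = (THE z. is_layer_potential M k q z)"

definition single_layer :: "nat \<Rightarrow> (int \<Rightarrow> real) \<Rightarrow> int \<Rightarrow> real" where
  "single_layer M q m = layer_potential M 0 q m 0"

definition double_layer :: "nat \<Rightarrow> (int \<Rightarrow> real) \<Rightarrow> int \<Rightarrow> real" where
  "double_layer M q m = layer_potential M (-1) q m 0 - layer_potential M 0 q m 0"

text \<open>
  A symmetric operator on \<open>nonzero_fourier M\<close> is determined by its quadratic form; the extensional
  function space fixes its values outside this subspace, which play no role.
\<close>

definition is_symmetric_operator ::
    "nat \<Rightarrow> ((int \<Rightarrow> real) \<Rightarrow> int \<Rightarrow> real) \<Rightarrow> bool" where
  "is_symmetric_operator M K \<longleftrightarrow>
     K \<in> nonzero_fourier M \<rightarrow>\<^sub>E nonzero_fourier M \<and>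
     (\<forall>p\<in>nonzero_fourier M. \<forall>q\<in>nonzero_fourier M. \<forall>a b.
        K (\<lambda>m. a * p m + b * q m) = (\<lambda>m. a * K p m + b * K q m)) \<and>
     (\<forall>p\<in>nonzero_fourier M. \<forall>q\<in>nonzero_fourier M.
        grid_inner M p (K q) = grid_inner M (K p) q)"

definition density_stiffness ::
    "nat \<Rightarrow> real \<Rightarrow> nat \<Rightarrow> real \<Rightarrow> ((int \<Rightarrow> real) \<Rightarrow> int \<Rightarrow> real)
      \<Rightarrow> (int \<Rightarrow> real) \<Rightarrow> int \<Rightarrow> real" where
  "density_stiffness M h d \<rho> P =
     (THE K. is_symmetric_operator M K \<and>
        (\<forall>q\<in>nonzero_fourier M. grid_inner M q (K q) = trace_energy M h d \<rho> (P q)))"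

definition eigenvalues :: "nat \<Rightarrow> ((int \<Rightarrow> real) \<Rightarrow> int \<Rightarrow> real) \<Rightarrow> real set" where
  "eigenvalues M K =
     {\<mu>. \<exists>q\<in>nonzero_fourier M. q \<noteq> (\<lambda>_. 0) \<and> K q = (\<lambda>m. \<mu> * q m)}"

definition lambda_min :: "nat \<Rightarrow> ((int \<Rightarrow> real) \<Rightarrow> int \<Rightarrow> real) \<Rightarrow> real" where
  "lambda_min M K = Min (eigenvalues M K)"

definition lambda_max :: "nat \<Rightarrow> ((int \<Rightarrow> real) \<Rightarrow> int \<Rightarrow> real) \<Rightarrow> real" where
  "lambda_max M K = Max (eigenvalues M K)"

definition condition_number :: "nat \<Rightarrow> ((int \<Rightarrow> real) \<Rightarrow> int \<Rightarrow> real) \<Rightarrow> real" where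
  "condition_number M K = lambda_max M K / lambda_min M K"

definition comparable :: "real \<Rightarrow> real \<Rightarrow> real \<Rightarrow> bool" where
  "comparable c a b \<longleftrightarrow> inverse c * b \<le> a \<and> a \<le> c * b"

end

theory Submission
  imports Defs
begin

text \<open>
  All operators are diagonalized by the discrete Fourier transform, written here with real kernels
  \<open>cos (\<theta> * (m - n))\<close>, so that symbols are functions of \<open>x = cos \<theta>\<close>. With the decay factor
  \<open>r = exp (- \<alpha>)\<close>, that is \<open>r + 1 / r = 4 - 2 * x\<close>, the layer potentials have the symbols
  \<open>r ^ \<bar>j - k\<bar> * r / (1 - r\<^sup>2)\<close>, the trace has the symbol \<open>g = r ^ d * (1 - \<rho> + \<rho> * r)\<close>, and
  \<open>2 - 2 * x = (1 - r)\<^sup>2 / r\<close>. The eigenvalues of the single-layer stiffness are therefore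
  \<open>g\<^sup>2 * r / (1 + r)\<^sup>2 / h\<close>, which is of order \<open>1 / h\<close> because \<open>1 / 6 \<le> r < 1\<close>. The double layer
  gains the factor \<open>(1 - r)\<^sup>2 = r * (2 - 2 * x)\<close>, which ranges from order \<open>M\<^sup>-\<^sup>2\<close> at the lowest
  frequency to order \<open>1\<close> at the highest one. Uniqueness of the harmonic extension and of the layer
  potentials holds because the energy of a layer is a convex function of the layer index.
\<close>

subsection \<open>Uniqueness of discrete harmonic functions\<close>

lemma grid_vector_mod:
  assumes "M > 0" "f \<in> grid_vectors M"
  shows "f (m mod int M) = f m"
proof -
  have per: "f (m + int M) = f m" for m
    using assms(2) by (simp add: grid_vectors_def)
  have *: "f (m + int M * int k) = f m" for m k
  proof (induction k)
    case (Suc k)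
    have "f (m + int M * int (Suc k)) = f ((m + int M * int k) + int M)"
      by (simp add: algebra_simps)
    then show ?case using Suc per by simp
  qed simp
  show ?thesis
  proof (cases "m div int M \<ge> 0")
    case True
    then show ?thesis using *[of "m mod int M" "nat (m div int M)"] by simp
  next
    case False
    then show ?thesis using *[of m "nat (- (m div int M))"]
      by (simp add: minus_div_mult_eq_mod[symmetric] mult.commute)
  qed
qed

lemma grid_vector_eq_0I:
  assumes "M > 0" "f \<in> grid_vectors M" "\<And>m. m < M \<Longrightarrow> f (int m) = 0"
  shows "f m = 0"
proof -
  have "m mod int M = int (nat (m mod int M))" "nat (m mod int M) < M"
    using assms(1) by (auto simp: nat_less_iff)
  then show ?thesis using assms grid_vector_mod by metis
qed

lemma sum_grid_shift:
  assumes "M > 0" "f \<in> grid_vectors M"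
  shows "(\<Sum>m<M. f (int m + 1)) = (\<Sum>m<M. f (int m))"
proof -
  have "f (int M) = f 0" using assms(2) by (auto simp: grid_vectors_def dest: spec[of _ 0])
  moreover have "(\<Sum>m<M. f (int m + 1) - f (int m)) = f (int M) - f 0"
    using sum_lessThan_telescope[of "\<lambda>m. f (int m)" M] by (simp add: add.commute)
  ultimately show ?thesis by (simp add: sum_subtractf)
qed

text \<open>A cyclic shift of the index makes the two neighbour cross terms have equal sums, so no
  boundary terms survive. The identity serves both the layer energy (uniqueness) and the trace
  energy.\<close>

lemma summation_by_parts_periodic:
  assumes "M > 0" "f \<in> grid_vectors M"
  shows "(\<Sum>m<M. f (int m) * (2 * f (int m) - f (int m + 1) - f (int m - 1)))
       = (\<Sum>m<M. (f (int m + 1) - f (int m))\<^sup>2)"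
proof -
  define g where "g m = f m * f (m - 1)" for m
  have per: "f (m + int M) = f m" for m
    using assms(2) by (simp add: grid_vectors_def)
  have g: "g \<in> grid_vectors M"
    using per[of "_ - 1"] per unfolding g_def grid_vectors_def by (simp add: algebra_simps)
  have f2: "(\<lambda>m. (f m)\<^sup>2) \<in> grid_vectors M"
    using per by (simp add: grid_vectors_def)
  have "(\<Sum>m<M. (f (int m + 1) - f (int m))\<^sup>2)
      = (\<Sum>m<M. (f (int m + 1))\<^sup>2) + (\<Sum>m<M. (f (int m))\<^sup>2) - 2 * (\<Sum>m<M. g (int m + 1))"
    by (simp add: g_def power2_diff sum.distrib sum_subtractf sum_distrib_left mult.assoc)
  also have "\<dots> = 2 * (\<Sum>m<M. (f (int m))\<^sup>2) - (\<Sum>m<M. g (int m + 1)) - (\<Sum>m<M. g (int m))"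
    using sum_grid_shift[OF assms(1) f2] sum_grid_shift[OF assms(1) g] by simp
  also have "\<dots> = (\<Sum>m<M. f (int m) * (2 * f (int m) - f (int m + 1) - f (int m - 1)))"
    by (simp add: g_def algebra_simps power2_eq_square sum.distrib sum_subtractf sum_distrib_left)
  finally show ?thesis by simp
qed

text \<open>Here \<open>f\<close> is a layer without source and \<open>g\<close>, \<open>k\<close>
  are the two adjacent layers. The five-point equation turns the second difference of the squares
  into two squares plus \<open>f\<close> times its negative tangential Laplacian, and summation by
  parts makes the latter nonnegative.\<close>

lemma slice_energy_convex:
  assumes "M > 0" "f \<in> grid_vectors M"
    and "\<And>m. 4 * f m - (f (m + 1) + f (m - 1) + g m + k m) = 0"
  shows "2 * (\<Sum>m<M. (f (int m))\<^sup>2) \<le> (\<Sum>m<M. (g (int m))\<^sup>2) + (\<Sum>m<M. (k (int m))\<^sup>2)"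
proof -
  have *: "(g m)\<^sup>2 + (k m)\<^sup>2 - 2 * (f m)\<^sup>2
     = (g m - f m)\<^sup>2 + (k m - f m)\<^sup>2 + 2 * (f m * (2 * f m - f (m + 1) - f (m - 1)))" for m
  proof -
    have e: "2 * f m - f (m + 1) - f (m - 1) = g m + k m - 2 * f m"
      using assms(3)[of m] by simp
    show ?thesis unfolding e by algebra
  qed
  have "(\<Sum>m<M. (g (int m))\<^sup>2) + (\<Sum>m<M. (k (int m))\<^sup>2) - 2 * (\<Sum>m<M. (f (int m))\<^sup>2)
    = (\<Sum>m<M. (g (int m) - f (int m))\<^sup>2) + (\<Sum>m<M. (k (int m) - f (int m))\<^sup>2)
      + 2 * (\<Sum>m<M. (f (int m + 1) - f (int m))\<^sup>2)"
    unfolding summation_by_parts_periodic[OF assms(1,2), symmetric]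
    unfolding sum_distrib_left sum_subtractf[symmetric] sum.distrib[symmetric] * ..
  also have "\<dots> \<ge> 0" by (intro add_nonneg_nonneg mult_nonneg_nonneg sum_nonneg) auto
  finally show ?thesis by simp
qed

text \<open>By convexity a positive increment would persist and force at least linear growth past
  \<open>B\<close>.\<close>

lemma convex_bounded_sequence_decreasing:
  fixes e :: "nat \<Rightarrow> real"
  assumes "\<And>j. 2 * e (j + 1) \<le> e j + e (j + 2)" "\<And>j. e j \<le> B"
  shows "e (j + 1) \<le> e j"
proof (rule ccontr)
  assume "\<not> e (j + 1) \<le> e j"
  then have pos: "e (j + 1) - e j > 0" by simp
  have step: "e (j + n + 1) - e (j + n) \<ge> e (j + 1) - e j" for n
  proof (induction n)
    case (Suc n)
    then show ?case using assms(1)[of "j + n"] by simp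
  qed simp
  have "e (j + n) \<ge> e j + real n * (e (j + 1) - e j)" for n
  proof (induction n)
    case (Suc n)
    then show ?case using step[of n] by (simp add: algebra_simps)
  qed simp
  moreover obtain n where "real n * (e (j + 1) - e j) > B - e j"
    using reals_Archimedean3[OF pos] by blast
  ultimately show False using assms(2)[of "j + n"] by (smt (verit))
qed

text \<open>The layer energy is convex and bounded, hence nonincreasing; it starts at 0 on layer 0
  and is nonnegative, so it vanishes.\<close>

lemma harmonic_extension_zero_unique:
  assumes "M > 0" "is_harmonic_extension M (\<lambda>_. 0) U"
  shows "U m j = 0"
proof -
  define e where "e j = (\<Sum>m<M. (U (int m) j)\<^sup>2)" for j
  have grid: "(\<lambda>m. U m j) \<in> grid_vectors M" for j
    using assms(2) by (simp add: is_harmonic_extension_def)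
  obtain B where B: "\<And>m j. \<bar>U m j\<bar> \<le> B"
    using assms(2) unfolding is_harmonic_extension_def bounded_iff by fastforce
  have "(U m j)\<^sup>2 \<le> B\<^sup>2" for m j
    using B[of m j] by (metis abs_ge_zero power2_abs power_mono)
  then have "e j \<le> real M * B\<^sup>2" for j
    unfolding e_def using sum_bounded_above[of "{..<M}" "\<lambda>m. (U (int m) j)\<^sup>2" "B\<^sup>2"] by simp
  moreover have "2 * e (j + 1) \<le> e j + e (j + 2)" for j
  proof -
    have "4 * U m (j + 1) - (U (m + 1) (j + 1) + U (m - 1) (j + 1) + U m (j + 2) + U m j) = 0" for m
    proof -
      have "\<forall>m. \<forall>j\<ge>1. 4 * U m j - (U (m + 1) j + U (m - 1) j + U m (j + 1) + U m (j - 1)) = 0"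
        using assms(2) unfolding is_harmonic_extension_def by blast
      from this[rule_format, of "j + 1" m] show ?thesis by simp
    qed
    then show ?thesis
      unfolding e_def
      using slice_energy_convex[OF assms(1) grid, of "j + 1" "\<lambda>m. U m j" "\<lambda>m. U m (j + 2)"]
      by (smt (verit))
  qed
  ultimately have dec: "e (j + 1) \<le> e j" for j
    using convex_bounded_sequence_decreasing[of e] by blast
  have "e j \<le> 0"
  proof (induction j)
    case 0
    then show ?case using assms(2) by (simp add: e_def is_harmonic_extension_def)
  next
    case (Suc j)
    then show ?case using dec[of j] by simp
  qed
  then have "e j = 0" unfolding e_def by (simp add: order_antisym sum_nonneg)
  then have "U (int m) j = 0" if "m < M" for m
    using that unfolding e_def by (simp add: sum_nonneg_eq_0_iff)
  then show ?thesis using grid_vector_eq_0I[OF assms(1) grid] by blast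
qed

lemma grid_vectors_diff:
  "f \<in> grid_vectors M \<Longrightarrow> g \<in> grid_vectors M \<Longrightarrow> (\<lambda>m. f m - g m) \<in> grid_vectors M"
  by (simp add: grid_vectors_def)

text \<open>Differences of two bounded extensions have zero data. Thus the description
  \<open>THE\<close> is evaluated by exhibiting any candidate; the explicit Fourier formula will be
  that candidate.\<close>

lemma harmonic_extension_eqI:
  assumes "M > 0" "is_harmonic_extension M V U"
  shows "harmonic_extension M V = U"
  unfolding harmonic_extension_def
proof (rule the_equality)
  show "is_harmonic_extension M V U" by fact
next
  fix U' assume U': "is_harmonic_extension M V U'"
  obtain B where B: "\<bar>U m j\<bar> \<le> B" for m j
    using assms(2) unfolding is_harmonic_extension_def bounded_iff by fastforce
  obtain B' where B': "\<bar>U' m j\<bar> \<le> B'" for m j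
    using U' unfolding is_harmonic_extension_def bounded_iff by fastforce
  have "norm (U' m j - U m j) \<le> B' + B" for m j
    using B[of m j] B'[of m j] by simp
  then have bdd: "bounded (range (\<lambda>(m, j). U' m j - U m j))"
    unfolding bounded_iff by fast
  have "U' m 0 - U m 0 = 0" for m
    using assms(2) U' by (simp add: is_harmonic_extension_def)
  moreover have "(\<lambda>m. U' m j - U m j) \<in> grid_vectors M" for j
    using assms(2) U' by (intro grid_vectors_diff) (simp_all add: is_harmonic_extension_def)
  moreover have "4 * (U' m j - U m j) - ((U' (m + 1) j - U (m + 1) j) + (U' (m - 1) j - U (m - 1) j)
      + (U' m (j + 1) - U m (j + 1)) + (U' m (j - 1) - U m (j - 1))) = 0" if "j \<ge> 1" for m j
  proof -
    have "4 * U m j - (U (m + 1) j + U (m - 1) j + U m (j + 1) + U m (j - 1)) = 0"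
      "4 * U' m j - (U' (m + 1) j + U' (m - 1) j + U' m (j + 1) + U' m (j - 1)) = 0"
      using assms(2) U' that unfolding is_harmonic_extension_def by blast+
    then show ?thesis by (simp add: algebra_simps)
  qed
  ultimately have "is_harmonic_extension M (\<lambda>_. 0) (\<lambda>m j. U' m j - U m j)"
    using bdd unfolding is_harmonic_extension_def by blast
  then have "U' m j - U m j = 0" for m j
    using harmonic_extension_zero_unique[OF assms(1)] by blast
  then show "U' = U" by (intro ext) simp
qed

text \<open>There is no boundary layer here: decay at plus infinity makes the convex energy
  nonincreasing on all of the integers, and decay at minus infinity then bounds it above by
  0.\<close>

lemma layer_potential_zero_unique:
  assumes "M > 0" "is_layer_potential M k (\<lambda>_. 0) z"
  shows "z m j = 0"
proof -
  define e where "e j = (\<Sum>m<M. (z (int m) j)\<^sup>2)" for j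
  have grid: "(\<lambda>m. z m j) \<in> grid_vectors M" for j
    using assms(2) by (simp add: is_layer_potential_def)
  have conv: "2 * e j \<le> e (j - 1) + e (j + 1)" for j
    unfolding e_def
    using slice_energy_convex[OF assms(1) grid, of j "\<lambda>m. z m (j - 1)" "\<lambda>m. z m (j + 1)"] assms(2)
    by (simp add: is_layer_potential_def algebra_simps)
  have lim: "(e \<longlongrightarrow> 0) at_top" "(e \<longlongrightarrow> 0) at_bot"
    unfolding e_def using assms(2)
    by (auto simp: is_layer_potential_def intro!: tendsto_null_sum tendsto_eq_intros)
  \<comment> \<open>The one-sided sequence starting at \<open>j\<close> converges, hence is bounded,
    so the lemma on natural indices applies to it.\<close>
  have dec: "e (j + 1) \<le> e j" for j
  proof -
    have "eventually (\<lambda>n. Z \<le> j + int n) sequentially" for Z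
      by (rule eventually_sequentiallyI[of "nat (Z - j)"]) simp
    then have "filterlim (\<lambda>n. j + int n) at_top sequentially"
      by (simp add: filterlim_at_top)
    then have "(\<lambda>n. e (j + int n)) \<longlonglongrightarrow> 0"
      using filterlim_compose[OF lim(1)] by blast
    then obtain B where "\<And>n. \<bar>e (j + int n)\<bar> \<le> B"
      by (metis Bseq_def convergentI convergent_imp_Bseq real_norm_def)
    then have "e (j + int n) \<le> B" for n by (smt (verit))
    moreover have "2 * e (j + int (n + 1)) \<le> e (j + int n) + e (j + int (n + 2))" for n
      using conv[of "j + int n + 1"] by (simp add: algebra_simps)
    ultimately show ?thesis
      using convex_bounded_sequence_decreasing[of "\<lambda>n. e (j + int n)" B 0] by simp
  qed
  have "e j \<le> e (j - int n)" for n
  proof (induction n)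
    case (Suc n)
    then show ?case using dec[of "j - int n - 1"] by (simp add: algebra_simps)
  qed simp
  then have le: "e j \<le> e i" if "i \<le> j" for i
    using that by (metis diff_diff_eq2 add_diff_cancel_left' nat_0_le diff_ge_0_iff_ge)
  \<comment> \<open>All values to the left of \<open>j\<close> dominate \<open>e j\<close>, so their
    limit 0 does too.\<close>
  have "e j \<le> 0"
    by (rule tendsto_lowerbound[OF lim(2)])
       (use le in \<open>auto simp: eventually_at_bot_linorder\<close>)
  then have "e j = 0" unfolding e_def by (simp add: order_antisym sum_nonneg)
  then have "z (int m) j = 0" if "m < M" for m
    using that unfolding e_def by (simp add: sum_nonneg_eq_0_iff)
  then show ?thesis using grid_vector_eq_0I[OF assms(1) grid] by blast
qed

lemma layer_potential_eqI:
  assumes "M > 0" "is_layer_potential M k q z"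
  shows "layer_potential M k q = z"
  unfolding layer_potential_def
proof (rule the_equality)
  show "is_layer_potential M k q z" by fact
next
  fix z' assume z': "is_layer_potential M k q z'"
  have grid: "(\<lambda>m. z' m j - z m j) \<in> grid_vectors M" for j
    using assms(2) z' unfolding is_layer_potential_def by (auto intro: grid_vectors_diff)
  have lim: "((\<lambda>j. z' m j - z m j) \<longlongrightarrow> 0) at_top" "((\<lambda>j. z' m j - z m j) \<longlongrightarrow> 0) at_bot" for m
    using assms(2) z' unfolding is_layer_potential_def by (auto intro!: tendsto_eq_intros)
  have "4 * (z' m j - z m j) - ((z' (m + 1) j - z (m + 1) j) + (z' (m - 1) j - z (m - 1) j)
      + (z' m (j + 1) - z m (j + 1)) + (z' m (j - 1) - z m (j - 1))) = 0" for m j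
  proof -
    have e: "4 * z m j - (z (m + 1) j + z (m - 1) j + z m (j + 1) + z m (j - 1)) = (if j = k then q m else 0)"
      and e': "4 * z' m j - (z' (m + 1) j + z' (m - 1) j + z' m (j + 1) + z' m (j - 1)) = (if j = k then q m else 0)"
      using assms(2) z' unfolding is_layer_potential_def by blast+
    show ?thesis using trans[OF e' e[symmetric]] by (simp add: algebra_simps)
  qed
  then have "is_layer_potential M k (\<lambda>_. 0) (\<lambda>m j. z' m j - z m j)"
    unfolding is_layer_potential_def using grid lim by auto
  then have "z' m j - z m j = 0" for m j
    using layer_potential_zero_unique[OF assms(1)] by blast
  then show "z' = z" by (intro ext) simp
qed

subsection \<open>Real Fourier multipliers\<close>

definition freq :: "nat \<Rightarrow> nat \<Rightarrow> real" where
  "freq M k = 2 * pi * real k / real M"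

text \<open>The symbol takes the same value at \<open>k\<close> and \<open>M - k\<close>, so the
  imaginary parts of the exponentials cancel and a cosine kernel suffices. Frequency
  \<open>k = 0\<close> is left out, which makes every image mean-free.\<close>

definition fourier_multiplier :: "nat \<Rightarrow> (real \<Rightarrow> real) \<Rightarrow> (int \<Rightarrow> real) \<Rightarrow> int \<Rightarrow> real" where
  "fourier_multiplier M a q m =
     (\<Sum>k=1..<M. \<Sum>n<M. a (cos (freq M k)) * q (int n) * cos (freq M k * of_int (m - int n)) / real M)"

section \<open>Orthogonality of the cosine waves\<close>

lemma sum_cos_full_period:
  fixes x :: real and j :: int
  assumes "M > 0"
  shows "(\<Sum>n<M. cos (x + 2 * pi * of_int j / real M * real n)) = (if int M dvd j then real M * cos x else 0)"
proof (cases "int M dvd j")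
  case True
  then obtain i where "j = int M * i" by blast
  then have "x + 2 * pi * of_int j / real M * real n = x + 2 * pi * of_int (i * int n)" for n
    using assms by simp
  then have "cos (x + 2 * pi * of_int j / real M * real n) = cos x" for n
    by (simp only: cos_add cos_int_2pin sin_int_2pin mult_zero_right mult_1_right diff_zero)
  then show ?thesis using True by simp
next
  case False
  define t where "t = 2 * pi * of_int j / real M"
  \<comment> \<open>A zero would make \<open>t / 2\<close> a multiple of pi and \<open>j\<close> a
    multiple of \<open>M\<close>; the factor can therefore be cancelled below.\<close>
  have "sin (t / 2) \<noteq> 0"
  proof
    assume "sin (t / 2) = 0"
    then obtain i :: int where "t / 2 = of_int i * pi"
      by (auto simp: sin_zero_iff_int2)
    then have "real_of_int j = of_int (i * int M)"
      using assms by (simp add: t_def field_simps)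
    then have "j = i * int M" by (simp only: of_int_eq_iff)
    then show False using False by simp
  qed
  moreover have "2 * sin (t / 2) * (\<Sum>n<M. cos (x + t * real n)) = 0"
  proof -
    \<comment> \<open>Multiplied by \<open>2 * sin (t / 2)\<close> the summands become differences
      of \<open>g\<close>, and \<open>g M = g 0\<close> because \<open>t * M\<close> is a multiple
      of the full period.\<close>
    define g where "g n = sin (x + t * real n - t / 2)" for n :: nat
    have "2 * sin (t / 2) * cos (x + t * real n) = g (Suc n) - g n" for n
      unfolding g_def sin_diff_sin by (simp add: algebra_simps add_divide_distrib)
    then have "2 * sin (t / 2) * (\<Sum>n<M. cos (x + t * real n)) = g M - g 0"
      by (simp add: sum_distrib_left sum_lessThan_telescope)
    also have "g M = sin (x - t / 2 + 2 * pi * of_int j)"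
      using assms by (simp add: g_def t_def algebra_simps)
    also have "\<dots> = g 0"
      by (simp only: sin_add cos_int_2pin sin_int_2pin) (simp add: g_def)
    finally show ?thesis by simp
  qed
  ultimately show ?thesis using False by (simp add: t_def)
qed

lemma sum_cos_freq:
  assumes "0 < k" "k < M"
  shows "(\<Sum>n<M. cos (x + freq M k * real n)) = 0"
proof -
  have "\<not> int M dvd int k" using assms by (auto dest: dvd_imp_le)
  then show ?thesis
    using sum_cos_full_period[of M x "int k"] assms by (simp add: freq_def)
qed

text \<open>The product formula leaves the frequencies \<open>l + k\<close> and
  \<open>l - k\<close>; the first resonates only for \<open>k = M - l\<close>, the second only for
  \<open>k = l\<close>. The extra summand covers \<open>k = l = M - l\<close>, where both resonate
  and the value doubles.\<close>

lemma cos_freq_convolution: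
  assumes k: "0 < k" "k < M" and l: "0 < l" "l < M"
  shows "(\<Sum>n<M. cos (freq M l * of_int (int n - p)) * cos (freq M k * of_int (m - int n)))
    = (if k = l \<or> k = M - l then real M / 2 * cos (freq M l * of_int (m - p)) else 0)
      + (if k = l \<and> k = M - l then real M / 2 * cos (freq M l * of_int (m - p)) else 0)"
proof -
  define X where "X = - freq M l * of_int p - freq M k * of_int m"
  define Y where "Y = - freq M l * of_int p + freq M k * of_int m"
  have M: "M > 0" using k by simp
  have "2 * (cos (freq M l * of_int (int n - p)) * cos (freq M k * of_int (m - int n)))
    = cos (X + 2 * pi * of_int (int l + int k) / real M * real n)
      + cos (Y + 2 * pi * of_int (int l - int k) / real M * real n)" for n
  proof -
    have "freq M l * of_int (int n - p) - freq M k * of_int (m - int n)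
        = X + 2 * pi * of_int (int l + int k) / real M * real n"
      "freq M l * of_int (int n - p) + freq M k * of_int (m - int n)
        = Y + 2 * pi * of_int (int l - int k) / real M * real n"
      using M by (simp_all add: X_def Y_def freq_def field_simps)
    then show ?thesis unfolding cos_times_cos by simp
  qed
  then have "2 * (\<Sum>n<M. cos (freq M l * of_int (int n - p)) * cos (freq M k * of_int (m - int n)))
    = (if int M dvd int l + int k then real M * cos X else 0)
      + (if int M dvd int l - int k then real M * cos Y else 0)"
    by (simp only: sum_distrib_left sum.distrib sum_cos_full_period[OF M])
  moreover have "int M dvd int l + int k \<longleftrightarrow> k = M - l"
  proof
    assume "int M dvd int l + int k"
    then obtain i where i: "int l + int k = int M * i" by blast
    \<comment> \<open>Both indices lie strictly between 0 and \<open>M\<close>, so the only possible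
      multiple of \<open>M\<close> is \<open>M\<close> itself.\<close>
    have "0 < int M * i" "int M * i < int M * 2" using i k l by linarith+
    then have "i = 1" using M by (simp add: zero_less_mult_iff)
    then show "k = M - l" using i by simp
  qed (use l in auto)
  moreover have "int M dvd int l - int k \<longleftrightarrow> k = l"
  proof
    assume "int M dvd int l - int k"
    moreover have "\<bar>int l - int k\<bar> < int M" using k l by linarith
    ultimately show "k = l" using zdvd_not_zless[of "\<bar>int l - int k\<bar>" "int M"] by fastforce
  qed simp
  moreover have "cos Y = cos (freq M l * of_int (m - p))" if "k = l"
    unfolding Y_def that by (simp add: algebra_simps)
  moreover have "cos X = cos (freq M l * of_int (m - p))" if "k = M - l"
  proof -
    have "X = freq M l * of_int (m - p) + 2 * pi * of_int (- m)"
      using M l by (simp add: X_def freq_def that of_nat_diff field_simps)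
    then show ?thesis
      by (simp only: cos_add cos_int_2pin sin_int_2pin mult_zero_right mult_1_right diff_zero)
  qed
  ultimately show ?thesis by (auto split: if_splits)
qed

lemma cos_freq_reflect:
  assumes "0 < k" "k < M"
  shows "cos (freq M (M - k)) = cos (freq M k)"
proof -
  have "freq M (M - k) = 2 * pi - freq M k"
    using assms by (simp add: freq_def of_nat_diff field_simps)
  then show ?thesis by (simp add: cos_diff)
qed

section \<open>Algebra of the multipliers\<close>

lemma fourier_multiplier_linear:
  "fourier_multiplier M a (\<lambda>m. b * p m + c * q m) m
   = b * fourier_multiplier M a p m + c * fourier_multiplier M a q m"
  unfolding fourier_multiplier_def sum_distrib_left sum.distrib[symmetric]
  by (intro sum.cong refl) (simp add: field_simps)

lemma fourier_multiplier_sum: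
  "fourier_multiplier M a (\<lambda>m. \<Sum>i\<in>I. f i m) m = (\<Sum>i\<in>I. fourier_multiplier M a (f i) m)"
proof (induction I rule: infinite_finite_induct)
  case (insert i I)
  then show ?case using fourier_multiplier_linear[of M a 1 "f i" 1] by simp
qed (simp_all add: fourier_multiplier_def)

lemma fourier_multiplier_scale:
  "fourier_multiplier M a (\<lambda>m. c * q m) m = c * fourier_multiplier M a q m"
  using fourier_multiplier_linear[of M a c q 0 q] by simp

lemma fourier_multiplier_symbol_linear:
  "fourier_multiplier M (\<lambda>x. b * f x + c * g x) q m
   = b * fourier_multiplier M f q m + c * fourier_multiplier M g q m"
  unfolding fourier_multiplier_def sum_distrib_left sum.distrib[symmetric]
  by (intro sum.cong refl) (simp add: field_simps)

text \<open>Cosine waves are eigenvectors: \<open>k = l\<close> and \<open>k = M - l\<close> each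
  contribute one half, with equal symbol values. The shift \<open>p\<close> is kept so that the
  kernels themselves, centred at any node, are covered.\<close>

lemma fourier_multiplier_cos:
  assumes "0 < l" "l < M"
  shows "fourier_multiplier M a (\<lambda>n. cos (freq M l * of_int (n - p))) m
    = a (cos (freq M l)) * cos (freq M l * of_int (m - p))"
proof -
  let ?C = "cos (freq M l * of_int (m - p))"
  have refl': "M - l \<in> {1..<M}" "l \<in> {1..<M}" using assms by auto
  have "fourier_multiplier M a (\<lambda>n. cos (freq M l * of_int (n - p))) m
    = (\<Sum>k=1..<M. a (cos (freq M k)) / real M *
        (\<Sum>n<M. cos (freq M l * of_int (int n - p)) * cos (freq M k * of_int (m - int n))))"
    unfolding fourier_multiplier_def sum_distrib_left
    by (intro sum.cong refl) (simp add: field_simps)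
  \<comment> \<open>Regrouped into two separate resonances, the formula also holds when
    \<open>l = M - l\<close>.\<close>
  also have "\<dots> = (\<Sum>k=1..<M. (if k = l then a (cos (freq M k)) * ?C / 2 else 0)
      + (if k = M - l then a (cos (freq M k)) * ?C / 2 else 0))"
    using assms by (intro sum.cong refl) (auto simp: cos_freq_convolution simp del: of_int_diff)
  also have "\<dots> = a (cos (freq M l)) * ?C"
    using refl' assms by (simp add: sum.distrib cos_freq_reflect)
  finally show ?thesis .
qed

text \<open>The inner image is a linear combination of shifted cosine waves, on each of which the
  outer multiplier acts as a scalar.\<close>

lemma fourier_multiplier_compose:
  "fourier_multiplier M a (fourier_multiplier M b q) m = fourier_multiplier M (\<lambda>x. a x * b x) q m"
proof -
  have "fourier_multiplier M b q = (\<lambda>m. \<Sum>k=1..<M. \<Sum>n<M.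
      (b (cos (freq M k)) * q (int n) / real M) * cos (freq M k * of_int (m - int n)))"
    by (simp add: fourier_multiplier_def field_simps fun_eq_iff)
  then have "fourier_multiplier M a (fourier_multiplier M b q) m = (\<Sum>k=1..<M. \<Sum>n<M.
      (b (cos (freq M k)) * q (int n) / real M)
        * fourier_multiplier M a (\<lambda>m. cos (freq M k * of_int (m - int n))) m)"
    by (simp only: fourier_multiplier_sum fourier_multiplier_scale)
  also have "\<dots> = fourier_multiplier M (\<lambda>x. a x * b x) q m"
    unfolding fourier_multiplier_def[of M "\<lambda>x. a x * b x"]
    by (intro sum.cong refl) (simp add: fourier_multiplier_cos del: of_int_diff)
  finally show ?thesis .
qed

lemma fourier_multiplier_cong:
  assumes "\<And>k. 0 < k \<Longrightarrow> k < M \<Longrightarrow> a (cos (freq M k)) = b (cos (freq M k))"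
  shows "fourier_multiplier M a q = fourier_multiplier M b q"
  unfolding fourier_multiplier_def using assms by (intro ext sum.cong refl) auto

text \<open>Adding the two addition formulas for the cosine cancels the sines and leaves the factor
  \<open>2 * cos \<theta>\<close>.\<close>

lemma fourier_multiplier_shift:
  "fourier_multiplier M a q (m + 1) + fourier_multiplier M a q (m - 1)
    = fourier_multiplier M (\<lambda>x. 2 * x * a x) q m"
proof -
  have "cos (t * of_int (m + 1 - int n)) + cos (t * of_int (m - 1 - int n))
      = 2 * cos t * cos (t * of_int (m - int n))" for t :: real and n
    by (simp add: cos_add cos_diff sin_add sin_diff algebra_simps)
  then have "a x * q (int n) * cos (t * of_int (m + 1 - int n)) / real M
      + a x * q (int n) * cos (t * of_int (m - 1 - int n)) / real M
      = 2 * cos t * a x * q (int n) * cos (t * of_int (m - int n)) / real M" for t n x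
    unfolding add_divide_distrib[symmetric] distrib_left[symmetric] by simp
  then show ?thesis
    unfolding fourier_multiplier_def sum.distrib[symmetric] by (intro sum.cong refl) blast
qed

lemma fourier_multiplier_nonzero_fourier:
  assumes "M > 0"
  shows "fourier_multiplier M a q \<in> nonzero_fourier M"
proof -
  have per: "cos (freq M k * of_int (m + int M - n)) = cos (freq M k * of_int (m - n))" for k m n
  proof -
    have "freq M k * of_int (m + int M - n) = freq M k * of_int (m - n) + 2 * pi * of_int (int k)"
      using assms by (simp add: freq_def field_simps)
    then show ?thesis
      by (simp only: cos_add cos_int_2pin sin_int_2pin mult_zero_right mult_1_right diff_zero)
  qed
  have "(\<Sum>m<M. cos (freq M k * of_int (int m - int n))) = 0" if "0 < k" "k < M" for k n
    using sum_cos_freq[OF that, of "- freq M k * real n"] by (simp add: algebra_simps)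
  then have "(\<Sum>k=1..<M. \<Sum>n<M. a (cos (freq M k)) * q (int n) / real M
      * (\<Sum>m<M. cos (freq M k * of_int (int m - int n)))) = 0"
    by (intro sum.neutral ballI) simp
  moreover have "(\<Sum>m<M. fourier_multiplier M a q (int m)) = (\<Sum>k=1..<M. \<Sum>n<M. a (cos (freq M k)) * q (int n) / real M
      * (\<Sum>m<M. cos (freq M k * of_int (int m - int n))))"
  proof -
    have "(\<Sum>m<M. fourier_multiplier M a q (int m))
      = (\<Sum>k=1..<M. \<Sum>m<M. \<Sum>n<M. a (cos (freq M k)) * q (int n) * cos (freq M k * of_int (int m - int n)) / real M)"
      unfolding fourier_multiplier_def by (rule sum.swap)
    also have "\<dots> = (\<Sum>k=1..<M. \<Sum>n<M. \<Sum>m<M. a (cos (freq M k)) * q (int n) * cos (freq M k * of_int (int m - int n)) / real M)"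
      by (intro sum.cong refl sum.swap)
    finally show ?thesis by (simp add: sum_distrib_left)
  qed
  moreover have "fourier_multiplier M a q (m + int M) = fourier_multiplier M a q m" for m
    by (simp only: fourier_multiplier_def per)
  ultimately show ?thesis
    by (simp add: nonzero_fourier_def grid_vectors_def)
qed

text \<open>The kernel depends on \<open>m - n\<close> through an even function, hence is
  symmetric.\<close>

lemma fourier_multiplier_self_adjoint:
  "grid_inner M p (fourier_multiplier M a q) = grid_inner M (fourier_multiplier M a p) q"
proof -
  have "cos (t * of_int (x - y)) = cos (t * of_int (y - x))" for t :: real and x y
    by (metis cos_minus minus_diff_eq mult_minus_right of_int_minus)
  then have *: "p x * (a t * q y * cos (s * of_int (x - y)) / real M)
      = a t * p x * cos (s * of_int (y - x)) / real M * q y" for x y t and s :: real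
    by (metis (no_types, lifting) mult.commute mult.left_commute times_divide_eq_left)
  have "grid_inner M p (fourier_multiplier M a q)
    = (\<Sum>m<M. \<Sum>k=1..<M. \<Sum>n<M. a (cos (freq M k)) * p (int m) * cos (freq M k * of_int (int n - int m)) / real M * q (int n))"
    unfolding grid_inner_def fourier_multiplier_def sum_distrib_left * ..
  also have "\<dots> = (\<Sum>n<M. \<Sum>k=1..<M. \<Sum>m<M. a (cos (freq M k)) * p (int m) * cos (freq M k * of_int (int n - int m)) / real M * q (int n))"
    by (subst sum.swap, subst (2) sum.swap, subst sum.swap) (rule refl)
  also have "\<dots> = grid_inner M (fourier_multiplier M a p) q"
    unfolding grid_inner_def fourier_multiplier_def sum_distrib_right ..
  finally show ?thesis .
qed

text \<open>Summed over all frequencies the kernel is the identity; the omitted \<open>k = 0\<close>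
  subtracts only the mean, which is zero for \<open>q\<close>.\<close>

lemma fourier_multiplier_one:
  assumes "q \<in> nonzero_fourier M" "M > 0"
  shows "fourier_multiplier M (\<lambda>_. 1) q = q"
proof
  fix m
  have q0: "(\<Sum>n<M. q (int n)) = 0" and grid: "q \<in> grid_vectors M"
    using assms(1) by (auto simp: nonzero_fourier_def)
  define r where "r = nat (m mod int M)"
  have r: "int r = m mod int M" "r < M"
    using assms(2) by (auto simp: r_def nat_less_iff)
  have dvd: "int M dvd m - int n \<longleftrightarrow> n = r" if "n < M" for n
  proof -
    have "int M dvd m - int n \<longleftrightarrow> m mod int M = int n mod int M"
      by (simp add: mod_eq_dvd_iff)
    then show ?thesis using that r by auto
  qed
  have split: "{..<M} = insert 0 {1..<M}" using assms(2) by auto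
  \<comment> \<open>The orthogonality sum is used with exchanged roles: it now runs over the
    frequency, and \<open>m - int n\<close> is the fixed integer.\<close>
  have full: "(\<Sum>k<M. cos (freq M k * of_int (m - int n))) = (if n = r then real M else 0)" if "n < M" for n
    using sum_cos_full_period[OF assms(2), of 0 "m - int n"] dvd[OF that]
    by (simp add: freq_def mult_ac)
  have head: "(\<Sum>k<M. cos (freq M k * of_int (m - int n)))
      = 1 + (\<Sum>k=1..<M. cos (freq M k * of_int (m - int n)))" for n
    by (simp add: split freq_def)
  have tail: "(\<Sum>k=1..<M. cos (freq M k * of_int (m - int n))) = (if n = r then real M else 0) - 1"
    if "n < M" for n
    using full[OF that] head[of n] by linarith
  have "(\<Sum>n<M. q (int n) / real M * (\<Sum>k=1..<M. cos (freq M k * of_int (m - int n))))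
    = (\<Sum>n<M. (if n = r then q (int n) else 0) - q (int n) / real M)"
  proof (intro sum.cong refl)
    fix n assume "n \<in> {..<M}"
    then have "n < M" by simp
    show "q (int n) / real M * (\<Sum>k=1..<M. cos (freq M k * of_int (m - int n)))
        = (if n = r then q (int n) else 0) - q (int n) / real M"
      unfolding tail[OF \<open>n < M\<close>] using assms(2) by (simp add: field_simps)
  qed
  also have "\<dots> = q (int r)"
    using r by (simp add: sum_subtractf sum_divide_distrib[symmetric] q0)
  also have "\<dots> = q m"
    using grid_vector_mod[OF assms(2) grid] r by simp
  finally show "fourier_multiplier M (\<lambda>_. 1) q m = q m"
    unfolding fourier_multiplier_def by (subst sum.swap) (simp add: sum_distrib_left)
qed

section \<open>Symmetric operators and the spectrum of a multiplier\<close>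

lemma nonzero_fourier_linear:
  assumes "p \<in> nonzero_fourier M" "q \<in> nonzero_fourier M"
  shows "(\<lambda>m. a * p m + b * q m) \<in> nonzero_fourier M"
  using assms by (simp add: nonzero_fourier_def grid_vectors_def sum.distrib sum_distrib_left[symmetric])

lemma grid_inner_linear:
  "grid_inner M (\<lambda>m. a * p m + b * q m) r = a * grid_inner M p r + b * grid_inner M q r"
  "grid_inner M r (\<lambda>m. a * p m + b * q m) = a * grid_inner M r p + b * grid_inner M r q"
  by (simp_all add: grid_inner_def sum.distrib sum_distrib_left algebra_simps)

lemma grid_inner_commute: "grid_inner M p q = grid_inner M q p"
  by (simp add: grid_inner_def mult.commute)

text \<open>Recovers the bilinear form from the quadratic one. The factors 1 are kept to match the
  shape of linearity in \<open>is_symmetric_operator\<close>.\<close>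

lemma symmetric_operator_polarization:
  assumes "is_symmetric_operator M K" "p \<in> nonzero_fourier M" "q \<in> nonzero_fourier M"
  shows "2 * grid_inner M p (K q)
    = grid_inner M (\<lambda>m. 1 * p m + 1 * q m) (K (\<lambda>m. 1 * p m + 1 * q m))
      - grid_inner M p (K p) - grid_inner M q (K q)"
proof -
  have "K (\<lambda>m. 1 * p m + 1 * q m) = (\<lambda>m. 1 * K p m + 1 * K q m)"
    using assms unfolding is_symmetric_operator_def by blast
  moreover have "grid_inner M q (K p) = grid_inner M p (K q)"
    using assms grid_inner_commute[of M "K q" p] unfolding is_symmetric_operator_def
    by (metis grid_inner_commute)
  ultimately show ?thesis by (simp only: grid_inner_linear) simp
qed

lemma symmetric_operator_eqI:
  assumes "M > 0" "is_symmetric_operator M K" "is_symmetric_operator M K'"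
    and "\<And>q. q \<in> nonzero_fourier M \<Longrightarrow> grid_inner M q (K q) = grid_inner M q (K' q)"
  shows "K = K'"
proof (rule PiE_ext)
  show KE: "K \<in> nonzero_fourier M \<rightarrow>\<^sub>E nonzero_fourier M" "K' \<in> nonzero_fourier M \<rightarrow>\<^sub>E nonzero_fourier M"
    using assms by (auto simp: is_symmetric_operator_def)
  fix q assume q: "q \<in> nonzero_fourier M"
  \<comment> \<open>Testing the polarized forms with the difference itself yields the squared norm
    of the difference.\<close>
  define p where "p = (\<lambda>m. 1 * K q m + (- 1) * K' q m)"
  have "K q \<in> nonzero_fourier M" "K' q \<in> nonzero_fourier M" using KE q by auto
  then have p: "p \<in> nonzero_fourier M" unfolding p_def by (rule nonzero_fourier_linear)
  have "2 * grid_inner M p (K q) = 2 * grid_inner M p (K' q)"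
    unfolding symmetric_operator_polarization[OF assms(2) p q]
      symmetric_operator_polarization[OF assms(3) p q]
    using p q nonzero_fourier_linear[OF p q] by (simp only: assms(4))
  then have "grid_inner M p p = 0"
    by (subst (2) p_def, subst grid_inner_linear) simp
  then have "p (int m) = 0" if "m < M" for m
    using that by (simp add: grid_inner_def sum_nonneg_eq_0_iff)
  then have "p m = 0" for m
    using grid_vector_eq_0I[OF assms(1)] p by (simp add: nonzero_fourier_def)
  then show "K q = K' q" by (intro ext) (simp add: p_def)
qed

lemma symmetric_operator_fourier_multiplier:
  assumes "M > 0"
  shows "is_symmetric_operator M (restrict (fourier_multiplier M a) (nonzero_fourier M))"
proof -
  have "fourier_multiplier M a (\<lambda>m. b * p m + c * q m)
      = (\<lambda>m. b * fourier_multiplier M a p m + c * fourier_multiplier M a q m)" for b c p q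
    by (rule ext) (rule fourier_multiplier_linear)
  then show ?thesis
    unfolding is_symmetric_operator_def
    by (simp add: fourier_multiplier_nonzero_fourier[OF assms] nonzero_fourier_linear
        fourier_multiplier_self_adjoint)
qed

lemma cos_freq_nonzero_fourier:
  assumes "0 < l" "l < M"
  shows "(\<lambda>n. cos (freq M l * of_int n)) \<in> nonzero_fourier M"
proof -
  \<comment> \<open>The wave is its own image under the symbol 1, and images are periodic and
    mean-free.\<close>
  have "(\<lambda>n. cos (freq M l * of_int n)) = fourier_multiplier M (\<lambda>_. 1) (\<lambda>n. cos (freq M l * of_int (n - 0)))"
    by (intro ext) (simp only: fourier_multiplier_cos[OF assms], simp)
  then show ?thesis using fourier_multiplier_nonzero_fourier[of M] assms by (metis less_trans)
qed

text \<open>If \<mu> is no symbol value, then \<open>a - \<mu>\<close> can be inverted at every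
  frequency, and composing with that inverse forces the eigenvector to vanish. Conversely each
  symbol value is attained on a cosine wave.\<close>

lemma eigenvalues_fourier_multiplier:
  assumes "M > 0"
  shows "eigenvalues M (restrict (fourier_multiplier M a) (nonzero_fourier M))
    = (\<lambda>k. a (cos (freq M k))) ` {1..<M}"
proof (intro equalityI subsetI)
  fix \<mu> assume "\<mu> \<in> eigenvalues M (restrict (fourier_multiplier M a) (nonzero_fourier M))"
  then obtain q where q: "q \<in> nonzero_fourier M" "q \<noteq> (\<lambda>_. 0)"
      "fourier_multiplier M a q = (\<lambda>m. \<mu> * q m)"
    by (auto simp: eigenvalues_def)
  show "\<mu> \<in> (\<lambda>k. a (cos (freq M k))) ` {1..<M}"
  proof (rule ccontr)
    assume notin: "\<not> ?thesis"
    define b where "b x = 1 * a x + (- \<mu>) * 1" for x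
    have "fourier_multiplier M b q m = 0" for m
      unfolding b_def fourier_multiplier_symbol_linear
      by (simp add: q fourier_multiplier_one[OF q(1) assms])
    then have "fourier_multiplier M (\<lambda>x. inverse (b x)) (fourier_multiplier M b q) = (\<lambda>_. 0)"
      by (intro ext) (simp add: fourier_multiplier_def[of M "\<lambda>x. inverse (b x)"])
    moreover have "fourier_multiplier M (\<lambda>x. inverse (b x)) (fourier_multiplier M b q)
        = fourier_multiplier M (\<lambda>x. inverse (b x) * b x) q"
      by (intro ext fourier_multiplier_compose)
    moreover have "fourier_multiplier M (\<lambda>x. inverse (b x) * b x) q = fourier_multiplier M (\<lambda>_. 1) q"
      using notin by (intro fourier_multiplier_cong) (auto simp: b_def image_iff intro!: left_inverse)
    ultimately show False
      using q(2) fourier_multiplier_one[OF q(1) assms] by simp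
  qed
next
  fix \<mu> assume "\<mu> \<in> (\<lambda>k. a (cos (freq M k))) ` {1..<M}"
  then obtain l where "l \<in> {1..<M}" and \<mu>: "\<mu> = a (cos (freq M l))" by blast
  then have l: "0 < l" "l < M" by auto
  let ?q = "\<lambda>n. cos (freq M l * of_int n)"
  have "?q \<noteq> (\<lambda>_. 0)"
  proof
    assume "?q = (\<lambda>_. 0)"
    then have "?q 0 = 0" by (rule fun_cong)
    then show False by simp
  qed
  moreover have "fourier_multiplier M a ?q = (\<lambda>m. \<mu> * ?q m)"
    using fourier_multiplier_cos[OF l, of a 0] \<mu> by (intro ext) simp
  ultimately show "\<mu> \<in> eigenvalues M (restrict (fourier_multiplier M a) (nonzero_fourier M))"
    unfolding eigenvalues_def using cos_freq_nonzero_fourier[OF l]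
    by (intro CollectI bexI[of _ ?q] conjI) auto
qed

subsection \<open>Symbols of the trace and layer operators\<close>

lemma pw_linear_derivative_integral:
  assumes "h > 0"
  shows "((\<lambda>s. (deriv (pw_linear h f) s)\<^sup>2) has_integral
      ((f (int i + 1) - f (int i))\<^sup>2 / h)) {real i * h..real (Suc i) * h}"
proof (rule has_integral_spike_finite)
  \<comment> \<open>The two nodes are discarded, as the derivative need not exist there; inside the
    cell the slope is constant.\<close>
  show "finite {real i * h, real (Suc i) * h}" by simp
  show "((\<lambda>_. ((f (int i + 1) - f (int i)) / h)\<^sup>2) has_integral
      ((f (int i + 1) - f (int i))\<^sup>2 / h)) {real i * h..real (Suc i) * h}"
  proof -
    have "real i * h \<le> real (Suc i) * h" using assms by simp
    then have "measure lborel {real i * h..real (Suc i) * h} = h" by (simp add: algebra_simps)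
    moreover have "h * ((f (int i + 1) - f (int i)) / h)\<^sup>2 = (f (int i + 1) - f (int i))\<^sup>2 / h"
      using assms by (simp add: power2_eq_square)
    ultimately show ?thesis
      using has_integral_const_real[of "((f (int i + 1) - f (int i)) / h)\<^sup>2" "real i * h" "real (Suc i) * h"]
      by simp
  qed
  fix s assume s: "s \<in> {real i * h..real (Suc i) * h} - {real i * h, real (Suc i) * h}"
  define g where "g t = (1 - (t / h - real i)) * f (int i) + (t / h - real i) * f (int i + 1)" for t
  have eq: "pw_linear h f t = g t" if "t \<in> {real i * h<..<real (Suc i) * h}" for t
  proof -
    have "real i < t / h" "t / h < real i + 1"
      using that assms by (auto simp: field_simps)
    then have "\<lfloor>t / h\<rfloor> = int i" by linarith
    then show ?thesis by (simp add: pw_linear_def g_def frac_def)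
  qed
  have "(g has_field_derivative (f (int i + 1) - f (int i)) / h) (at s)"
    unfolding g_def by (auto intro!: derivative_eq_intros simp: assms[THEN less_imp_neq, symmetric] diff_divide_distrib)
  then have "(pw_linear h f has_field_derivative (f (int i + 1) - f (int i)) / h) (at s)"
    by (rule has_field_derivative_transform_within_open[of _ _ _ "{real i * h<..<real (Suc i) * h}"])
       (use s eq in auto)
  then show "(deriv (pw_linear h f) s)\<^sup>2 = ((f (int i + 1) - f (int i)) / h)\<^sup>2"
    by (simp add: DERIV_imp_deriv)
qed

lemma pw_linear_energy:
  assumes "h > 0"
  shows "((\<lambda>s. (deriv (pw_linear h f) s)\<^sup>2) has_integral
      (\<Sum>m<M. (f (int m + 1) - f (int m))\<^sup>2) / h) {0..real M * h}"
proof (induction M)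
  case (Suc M)
  have "((\<lambda>s. (deriv (pw_linear h f) s)\<^sup>2) has_integral
      (\<Sum>m<M. (f (int m + 1) - f (int m))\<^sup>2) / h + (f (int M + 1) - f (int M))\<^sup>2 / h) {0..real (Suc M) * h}"
  proof (rule has_integral_combine[OF _ _ Suc pw_linear_derivative_integral])
    show "0 \<le> real M * h" "real M * h \<le> real (Suc M) * h"
      using assms by (simp_all add: mult_right_mono)
  qed fact
  then show ?case by (simp only: sum.lessThan_Suc add_divide_distrib)
next
  case 0
  show ?case using has_integral_refl(2)[of _ "0::real"] by simp
qed

text \<open>The smaller root of \<open>r + 1 / r = 4 - 2 * x\<close>; the other root is its
  reciprocal and gives the growing mode.\<close>

definition decay :: "real \<Rightarrow> real" where
  "decay x = 2 - x - sqrt ((2 - x)\<^sup>2 - 1)"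

text \<open>The condition \<open>x < 1\<close> excludes frequency zero, where the factor would equal
  1. The bound by 1/6 makes later constants independent of the frequency.\<close>

lemma decay_props:
  assumes "-1 \<le> x" "x < 1"
  shows "0 < decay x" and "decay x < 1"
    and "(decay x)\<^sup>2 + 1 = (4 - 2 * x) * decay x"
    and "1 / 6 \<le> decay x"
proof -
  define t where "t = 2 - x"
  define w where "w = sqrt (t\<^sup>2 - 1)"
  have t: "1 < t" "t \<le> 3" using assms by (auto simp: t_def)
  have "1 < t\<^sup>2" using t by (simp add: one_less_power)
  then have w: "w\<^sup>2 = t\<^sup>2 - 1" "0 < w" by (auto simp: w_def)
  have r: "decay x = t - w" by (simp add: decay_def t_def w_def)
  have "w < t" using w t by (intro power2_less_imp_less[of w t]) auto
  then show pos: "0 < decay x" using r by simp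
  show quad: "(decay x)\<^sup>2 + 1 = (4 - 2 * x) * decay x"
    using w by (simp add: r t_def power2_eq_square algebra_simps)
  have "(t - 1)\<^sup>2 < w\<^sup>2" using t w by (simp add: power2_eq_square algebra_simps)
  then have "t - 1 < w" using w(2) by (rule power2_less_imp_less[OF _ less_imp_le])
  then show "decay x < 1" using r by simp
  \<comment> \<open>The quadratic equation bounds \<open>decay x\<close> below by
    \<open>1 / (4 - 2 * x)\<close>, which is smallest at \<open>x = -1\<close>.\<close>
  have "1 \<le> (4 - 2 * x) * decay x" unfolding quad[symmetric] by simp
  also have "\<dots> \<le> 6 * decay x" using pos assms by (intro mult_right_mono) auto
  finally show "1 / 6 \<le> decay x" by simp
qed

lemma cos_freq_eq: "cos (freq M k) = 1 - 2 * (sin (pi * real k / real M))\<^sup>2"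
  using cos_double_sin[of "pi * real k / real M"] by (simp add: freq_def mult_ac)

lemma cos_freq_less_1:
  assumes "0 < k" "k < M"
  shows "cos (freq M k) < 1"
proof -
  have "0 < sin (pi * real k / real M)"
    using assms by (intro sin_gt_zero) (auto simp: field_simps)
  then show ?thesis by (simp add: cos_freq_eq)
qed

lemmas decay_freq = decay_props[OF cos_ge_minus_one cos_freq_less_1]

text \<open>Reduces the five-point equation to a three-term relation per frequency: \<open>f\<close>
  is the symbol of a layer, \<open>g\<close> and \<open>h\<close> those of the adjacent layers,
  \<open>e\<close> that of the source. Here \<open>h\<close> is not the grid spacing.\<close>

lemma five_point_fourier_multiplier:
  assumes "\<And>k. 0 < k \<Longrightarrow> k < M \<Longrightarrow>
    (4 - 2 * cos (freq M k)) * f (cos (freq M k)) - g (cos (freq M k)) - h (cos (freq M k)) = e (cos (freq M k))"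
  shows "4 * fourier_multiplier M f q m
     - (fourier_multiplier M f q (m + 1) + fourier_multiplier M f q (m - 1)
        + fourier_multiplier M g q m + fourier_multiplier M h q m) = fourier_multiplier M e q m"
proof -
  have "fourier_multiplier M e q m
      = fourier_multiplier M (\<lambda>x. 4 * f x + (- 1) * (1 * (2 * x * f x) + 1 * (1 * g x + 1 * h x))) q m"
    using assms by (intro fun_cong[OF fourier_multiplier_cong]) (force simp: algebra_simps)
  then show ?thesis
    unfolding fourier_multiplier_symbol_linear fourier_multiplier_shift[symmetric] by simp
qed

lemma fourier_multiplier_bound:
  assumes "\<And>k. 0 < k \<Longrightarrow> k < M \<Longrightarrow> \<bar>f (cos (freq M k))\<bar> \<le> \<bar>p (cos (freq M k))\<bar>"
  shows "\<bar>fourier_multiplier M f q m\<bar> \<le> (\<Sum>k=1..<M. \<Sum>n<M. \<bar>p (cos (freq M k))\<bar> * \<bar>q (int n)\<bar>)"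
  unfolding fourier_multiplier_def
proof (intro sum_abs[THEN order_trans] sum_mono)
  fix k n assume k: "k \<in> {1..<M}"
  have "\<bar>cos (freq M k * of_int (m - int n))\<bar> / real M \<le> 1 / 1"
    using k by (intro frac_le) auto
  then have "(\<bar>f (cos (freq M k))\<bar> * \<bar>q (int n)\<bar>) * (\<bar>cos (freq M k * of_int (m - int n))\<bar> / real M)
      \<le> (\<bar>p (cos (freq M k))\<bar> * \<bar>q (int n)\<bar>) * 1"
    using k assms by (intro mult_mono) auto
  then show "\<bar>f (cos (freq M k)) * q (int n) * cos (freq M k * of_int (m - int n)) / real M\<bar>
      \<le> \<bar>p (cos (freq M k))\<bar> * \<bar>q (int n)\<bar>"
    by (simp add: abs_mult)
qed

text \<open>Powers of a root of the characteristic equation solve the three-term relation, and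
  powers of a number below 1 stay bounded.\<close>

lemma harmonic_extension_fourier_multiplier:
  assumes "M > 0"
  shows "harmonic_extension M (fourier_multiplier M p q)
    = (\<lambda>m j. fourier_multiplier M (\<lambda>x. decay x ^ j * p x) q m)"
proof (rule harmonic_extension_eqI[OF assms])
  let ?U = "\<lambda>m j. fourier_multiplier M (\<lambda>x. decay x ^ j * p x) q m"
  have "\<bar>?U m j\<bar> \<le> (\<Sum>k=1..<M. \<Sum>n<M. \<bar>p (cos (freq M k))\<bar> * \<bar>q (int n)\<bar>)" for m j
  proof (rule fourier_multiplier_bound)
    fix k assume k: "0 < k" "k < M"
    then have "\<bar>decay (cos (freq M k)) ^ j\<bar> \<le> 1"
      using decay_freq[OF k] by (simp add: power_le_one)
    then show "\<bar>decay (cos (freq M k)) ^ j * p (cos (freq M k))\<bar> \<le> \<bar>p (cos (freq M k))\<bar>"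
      unfolding abs_mult by (rule mult_left_le_one_le[rotated 2]) auto
  qed
  then have "bounded (range (\<lambda>(m, j). ?U m j))"
    unfolding bounded_iff by fastforce
  moreover have "4 * ?U m j - (?U (m + 1) j + ?U (m - 1) j + ?U m (j + 1) + ?U m (j - 1)) = 0"
    if "j \<ge> 1" for m j
  proof -
    define i where "i = j - 1"
    have i: "j = Suc i" using that by (simp add: i_def)
    have "4 * ?U m j - (?U (m + 1) j + ?U (m - 1) j + ?U m (j + 1) + ?U m (j - 1))
        = fourier_multiplier M (\<lambda>_. 0) q m"
    proof (rule five_point_fourier_multiplier)
      fix k assume k: "0 < k" "k < M"
      let ?x = "cos (freq M k)"
      have "(4 - 2 * ?x) * (decay ?x ^ j * p ?x) - decay ?x ^ (j + 1) * p ?x - decay ?x ^ (j - 1) * p ?x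
        = decay ?x ^ i * p ?x * ((4 - 2 * ?x) * decay ?x - ((decay ?x)\<^sup>2 + 1))"
        by (simp add: i power2_eq_square algebra_simps)
      then show "(4 - 2 * ?x) * (decay ?x ^ j * p ?x) - decay ?x ^ (j + 1) * p ?x - decay ?x ^ (j - 1) * p ?x = 0"
        using decay_freq(3)[OF k] by simp
    qed
    then show ?thesis by (simp add: fourier_multiplier_def[of M "\<lambda>_. 0"])
  qed
  ultimately show "is_harmonic_extension M (fourier_multiplier M p q) ?U"
    using fourier_multiplier_nonzero_fourier[OF assms]
    unfolding is_harmonic_extension_def nonzero_fourier_def by auto
qed

definition trace_symbol :: "nat \<Rightarrow> real \<Rightarrow> real \<Rightarrow> real" where
  "trace_symbol d \<rho> x = (1 - \<rho>) * decay x ^ d + \<rho> * decay x ^ (d + 1)"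

lemma trace_values_fourier_multiplier:
  assumes "M > 0"
  shows "trace_values M d \<rho> (fourier_multiplier M p q)
    = fourier_multiplier M (\<lambda>x. trace_symbol d \<rho> x * p x) q"
proof
  fix m
  have "(\<lambda>x. trace_symbol d \<rho> x * p x)
      = (\<lambda>x. (1 - \<rho>) * (decay x ^ d * p x) + \<rho> * (decay x ^ (d + 1) * p x))"
    by (simp add: trace_symbol_def algebra_simps)
  then show "trace_values M d \<rho> (fourier_multiplier M p q) m
      = fourier_multiplier M (\<lambda>x. trace_symbol d \<rho> x * p x) q m"
    by (simp only: trace_values_def harmonic_extension_fourier_multiplier[OF assms]
        fourier_multiplier_symbol_linear)
qed

text \<open>This is \<open>1 / (1 / r - r)\<close>, that is \<open>1 / (2 * sinh \<alpha>)\<close>,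
  the value at the source row of the one-dimensional Green's function of a frequency.\<close>

definition layer_symbol :: "real \<Rightarrow> real" where
  "layer_symbol x = decay x / (1 - (decay x)\<^sup>2)"

lemma tendsto_power_abs_int_diff:
  fixes r :: real
  assumes "0 < r" "r < 1"
  shows "((\<lambda>j. r ^ nat \<bar>j - k\<bar>) \<longlongrightarrow> 0) at_top" "((\<lambda>j. r ^ nat \<bar>j - k\<bar>) \<longlongrightarrow> 0) at_bot"
proof -
  have lim: "(\<lambda>n. r ^ n) \<longlonglongrightarrow> 0" using assms by (intro LIMSEQ_power_zero) auto
  have "eventually (\<lambda>j. Z \<le> nat \<bar>j - k\<bar>) at_top" for Z
    using eventually_ge_at_top[of "k + int Z"] by eventually_elim auto
  then have "filterlim (\<lambda>j. nat \<bar>j - k\<bar>) sequentially at_top"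
    by (simp add: filterlim_at_top)
  then show "((\<lambda>j. r ^ nat \<bar>j - k\<bar>) \<longlongrightarrow> 0) at_top" by (rule filterlim_compose[OF lim])
  have "eventually (\<lambda>j. Z \<le> nat \<bar>j - k\<bar>) at_bot" for Z
    using eventually_le_at_bot[of "k - int Z"] by eventually_elim auto
  then have "filterlim (\<lambda>j. nat \<bar>j - k\<bar>) sequentially at_bot"
    by (simp add: filterlim_at_top)
  then show "((\<lambda>j. r ^ nat \<bar>j - k\<bar>) \<longlongrightarrow> 0) at_bot" by (rule filterlim_compose[OF lim])
qed

text \<open>Geometric decay on both sides solves the homogeneous relation away from row
  \<open>k\<close>; \<open>layer_symbol\<close> is the amplitude for which the defect at row
  \<open>k\<close> is exactly 1.\<close>

lemma layer_potential_fourier_multiplier: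
  assumes "M > 0" "q \<in> nonzero_fourier M"
  shows "layer_potential M k q
    = (\<lambda>m j. fourier_multiplier M (\<lambda>x. decay x ^ nat \<bar>j - k\<bar> * layer_symbol x) q m)"
proof (rule layer_potential_eqI[OF assms(1)])
  let ?f = "\<lambda>j x. decay x ^ nat \<bar>j - k\<bar> * layer_symbol x"
  let ?z = "\<lambda>m j. fourier_multiplier M (?f j) q m"
  have "(?z m \<longlongrightarrow> 0) at_top \<and> (?z m \<longlongrightarrow> 0) at_bot" for m
    unfolding fourier_multiplier_def
    by (intro conjI tendsto_null_sum; (intro tendsto_divide_zero tendsto_mult_left_zero tendsto_power_abs_int_diff)?)
       (auto simp: decay_freq)
  moreover have "4 * ?z m j - (?z (m + 1) j + ?z (m - 1) j + ?z m (j + 1) + ?z m (j - 1))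
      = (if j = k then q m else 0)" for m j
  proof -
    have "4 * ?z m j - (?z (m + 1) j + ?z (m - 1) j + ?z m (j + 1) + ?z m (j - 1))
        = fourier_multiplier M (\<lambda>_. if j = k then 1 else 0) q m"
    proof (rule five_point_fourier_multiplier)
      fix l assume l: "0 < l" "l < M"
      define x where "x = cos (freq M l)"
      define r where "r = decay x"
      define s where "s = layer_symbol x"
      have r: "0 < r" "r < 1" and quad: "(4 - 2 * x) * r = r\<^sup>2 + 1"
        using decay_freq[OF l] by (auto simp: r_def x_def)
      have "r\<^sup>2 < 1" using r by (simp add: power_less_one_iff)
      then have s: "s * (1 - r\<^sup>2) = r" by (simp add: s_def layer_symbol_def r_def)
      have "(4 - 2 * x) * (r ^ nat \<bar>j - k\<bar> * s) - r ^ nat \<bar>j + 1 - k\<bar> * s - r ^ nat \<bar>j - 1 - k\<bar> * s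
        = (if j = k then 1 else 0)"
      proof (cases "j = k")
        case True
        have "r * ((4 - 2 * x) * s - r * s - r * s) = s * ((4 - 2 * x) * r) - 2 * r\<^sup>2 * s"
          by (simp add: power2_eq_square algebra_simps)
        also have "\<dots> = s * (1 - r\<^sup>2)" unfolding quad by (simp add: algebra_simps)
        finally have "(4 - 2 * x) * s - r * s - r * s = 1" using s r by simp
        then show ?thesis using True by simp
      next
        case False
        \<comment> \<open>The adjacent rows are at distances \<open>i\<close> and
          \<open>i + 2\<close> from the source, in an order depending on the side.\<close>
        define i where "i = nat \<bar>j - k\<bar> - 1"
        have i: "nat \<bar>j - k\<bar> = Suc i" using False by (simp add: i_def)
        have "r ^ nat \<bar>j + 1 - k\<bar> + r ^ nat \<bar>j - 1 - k\<bar> = r ^ i * (r\<^sup>2 + 1)"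
        proof (cases "j > k")
          case True
          then have e: "nat \<bar>j + 1 - k\<bar> = i + 2" "nat \<bar>j - 1 - k\<bar> = i" using i by linarith+
          show ?thesis unfolding e by (simp add: power_add algebra_simps power2_eq_square)
        next
          case False
          then have e: "nat \<bar>j + 1 - k\<bar> = i" "nat \<bar>j - 1 - k\<bar> = i + 2" using i \<open>j \<noteq> k\<close> by linarith+
          show ?thesis unfolding e by (simp add: power_add algebra_simps power2_eq_square)
        qed
        then have "r ^ nat \<bar>j + 1 - k\<bar> * s + r ^ nat \<bar>j - 1 - k\<bar> * s = r ^ i * ((4 - 2 * x) * r) * s"
          unfolding quad by (metis distrib_right)
        then show ?thesis using False by (simp add: i algebra_simps)
      qed
      then show "(4 - 2 * cos (freq M l)) * ?f j (cos (freq M l)) - ?f (j + 1) (cos (freq M l))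
          - ?f (j - 1) (cos (freq M l)) = (if j = k then 1 else 0)"
        by (simp only: x_def r_def s_def)
    qed
    \<comment> \<open>At the source row the symbol 1 reproduces \<open>q\<close> because
      \<open>q\<close> is mean-free.\<close>
    also have "\<dots> = (if j = k then q m else 0)"
      using fourier_multiplier_one[OF assms(2,1)] by (simp add: fourier_multiplier_def[of M "\<lambda>_. 0"])
    finally show ?thesis .
  qed
  ultimately show "is_layer_potential M k q ?z"
    using fourier_multiplier_nonzero_fourier[OF assms(1)]
    unfolding is_layer_potential_def nonzero_fourier_def by auto
qed

section \<open>Layer operators and density stiffness as multipliers\<close>

lemma single_layer_fourier_multiplier:
  assumes "M > 0" "q \<in> nonzero_fourier M"
  shows "single_layer M q = fourier_multiplier M layer_symbol q"
  by (rule ext) (simp add: single_layer_def layer_potential_fourier_multiplier[OF assms])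

text \<open>The evaluation row 0 is at distance one from the source row -1, whence one factor
  \<open>decay x\<close>.\<close>

lemma double_layer_fourier_multiplier:
  assumes "M > 0" "q \<in> nonzero_fourier M"
  shows "double_layer M q = fourier_multiplier M (\<lambda>x. (decay x - 1) * layer_symbol x) q"
proof
  fix m
  have "double_layer M q m = fourier_multiplier M (\<lambda>x. 1 * (decay x * layer_symbol x) + (- 1) * layer_symbol x) q m"
    unfolding fourier_multiplier_symbol_linear
    by (simp add: double_layer_def layer_potential_fourier_multiplier[OF assms])
  then show "double_layer M q m = fourier_multiplier M (\<lambda>x. (decay x - 1) * layer_symbol x) q m"
    by (simp add: algebra_simps)
qed

text \<open>Summation by parts turns squared differences into the tangential Laplacian with symbol
  \<open>2 - 2 * x\<close>; self-adjointness then moves the remaining copy of the trace onto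
  \<open>q\<close>.\<close>

lemma trace_energy_fourier_multiplier:
  assumes "M > 0" "h > 0"
  shows "trace_energy M h d \<rho> (fourier_multiplier M p q)
    = grid_inner M q (fourier_multiplier M (\<lambda>x. (2 - 2 * x) * (trace_symbol d \<rho> x * p x)\<^sup>2 / h) q)"
proof -
  let ?g = "\<lambda>x. trace_symbol d \<rho> x * p x"
  let ?w = "fourier_multiplier M ?g q"
  have grid: "?w \<in> grid_vectors M"
    using fourier_multiplier_nonzero_fourier[OF assms(1)] by (simp add: nonzero_fourier_def)
  have lap: "2 * ?w m - ?w (m + 1) - ?w (m - 1) = fourier_multiplier M (\<lambda>x. (2 - 2 * x) * ?g x) q m" for m
  proof -
    have "2 * ?w m - (?w (m + 1) + ?w (m - 1))
        = fourier_multiplier M (\<lambda>x. 2 * ?g x + (- 1) * (2 * x * ?g x)) q m"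
      unfolding fourier_multiplier_symbol_linear fourier_multiplier_shift by simp
    then show ?thesis by (simp add: algebra_simps)
  qed
  have "trace_energy M h d \<rho> (fourier_multiplier M p q) = (\<Sum>m<M. (?w (int m + 1) - ?w (int m))\<^sup>2) / h"
    unfolding trace_energy_def trace_function_def trace_values_fourier_multiplier[OF assms(1)]
    by (rule integral_unique[OF pw_linear_energy[OF assms(2)]])
  also have "\<dots> = grid_inner M ?w (fourier_multiplier M (\<lambda>x. (2 - 2 * x) * ?g x) q) / h"
    unfolding summation_by_parts_periodic[OF assms(1) grid, symmetric] lap grid_inner_def ..
  also have "\<dots> = grid_inner M q (fourier_multiplier M (\<lambda>x. ?g x * ((2 - 2 * x) * ?g x)) q) / h"
    by (simp only: fourier_multiplier_self_adjoint[symmetric] fourier_multiplier_compose[abs_def])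
  also have "\<dots> = grid_inner M q (fourier_multiplier M (\<lambda>x. (2 - 2 * x) * (?g x)\<^sup>2 / h) q)"
    by (simp add: grid_inner_def fourier_multiplier_def sum_distrib_left sum_divide_distrib
        power2_eq_square mult_ac)
  finally show ?thesis .
qed

text \<open>The multiplier realizes the quadratic form, and polarization shows that no other
  symmetric operator does. The restriction supplies the extensionality demanded of
  operators.\<close>

lemma density_stiffness_fourier_multiplier:
  assumes "M > 0" "h > 0" "\<And>q. q \<in> nonzero_fourier M \<Longrightarrow> P q = fourier_multiplier M p q"
  shows "density_stiffness M h d \<rho> P
    = restrict (fourier_multiplier M (\<lambda>x. (2 - 2 * x) * (trace_symbol d \<rho> x * p x)\<^sup>2 / h)) (nonzero_fourier M)"
    (is "_ = ?K")
  unfolding density_stiffness_def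
proof (rule the_equality)
  have K: "grid_inner M q (?K q) = trace_energy M h d \<rho> (P q)" if "q \<in> nonzero_fourier M" for q
    using that by (simp add: assms trace_energy_fourier_multiplier)
  show "is_symmetric_operator M ?K \<and> (\<forall>q\<in>nonzero_fourier M. grid_inner M q (?K q) = trace_energy M h d \<rho> (P q))"
    using K symmetric_operator_fourier_multiplier[OF assms(1)] by blast
  fix K' assume "is_symmetric_operator M K' \<and>
    (\<forall>q\<in>nonzero_fourier M. grid_inner M q (K' q) = trace_energy M h d \<rho> (P q))"
  then show "K' = ?K"
    using K symmetric_operator_fourier_multiplier[OF assms(1)]
    by (intro symmetric_operator_eqI[OF assms(1)]) auto
qed

lemma eigenvalues_density_stiffness:
  assumes "M > 0" "h > 0" "\<And>q. q \<in> nonzero_fourier M \<Longrightarrow> P q = fourier_multiplier M p q"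
  shows "eigenvalues M (density_stiffness M h d \<rho> P)
    = (\<lambda>k. (2 - 2 * cos (freq M k)) * (trace_symbol d \<rho> (cos (freq M k)) * p (cos (freq M k)))\<^sup>2 / h) ` {1..<M}"
proof -
  have "density_stiffness M h d \<rho> P
    = restrict (fourier_multiplier M (\<lambda>x. (2 - 2 * x) * (trace_symbol d \<rho> x * p x)\<^sup>2 / h)) (nonzero_fourier M)"
    by (intro density_stiffness_fourier_multiplier assms)
  then show ?thesis by (simp only: eigenvalues_fourier_multiplier[OF assms(1)])
qed

subsection \<open>Eigenvalue bounds\<close>

text \<open>A convex combination of two powers of \<open>decay x\<close> with exponents at most
  \<open>D + 1\<close>. This is the source of uniformity in the cut offset.\<close>

lemma trace_symbol_bounds:
  assumes "-1 \<le> x" "x < 1" "d \<le> D" "0 \<le> \<rho>" "\<rho> \<le> 1"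
  shows "(1 / 6) ^ (D + 1) \<le> trace_symbol d \<rho> x" "trace_symbol d \<rho> x \<le> 1"
proof -
  let ?r = "decay x"
  have r: "0 < ?r" "?r < 1" "1 / 6 \<le> ?r" using decay_props[OF assms(1,2)] by auto
  have le: "(1 / 6) ^ (D + 1) \<le> ?r ^ i" "?r ^ i \<le> 1" if "i \<le> D + 1" for i
  proof -
    have "(1 / 6 :: real) ^ (D + 1) \<le> (1 / 6) ^ i" using that by (intro power_decreasing) auto
    also have "\<dots> \<le> ?r ^ i" using r by (intro power_mono) auto
    finally show "(1 / 6) ^ (D + 1) \<le> ?r ^ i" .
    show "?r ^ i \<le> 1" using r by (simp add: power_le_one)
  qed
  have convex: "(1 - \<rho>) * c + \<rho> * c = c" for c
    by (simp add: algebra_simps)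
  have "(1 - \<rho>) * (1 / 6) ^ (D + 1) + \<rho> * (1 / 6) ^ (D + 1) \<le> trace_symbol d \<rho> x"
    unfolding trace_symbol_def using assms by (intro add_mono mult_left_mono le) auto
  then show "(1 / 6) ^ (D + 1) \<le> trace_symbol d \<rho> x" unfolding convex .
  have "trace_symbol d \<rho> x \<le> (1 - \<rho>) * 1 + \<rho> * 1"
    unfolding trace_symbol_def using assms by (intro add_mono mult_left_mono le) auto
  then show "trace_symbol d \<rho> x \<le> 1" by simp
qed

text \<open>The zero of \<open>2 - 2 * x\<close> at low frequency cancels the pole of the squared
  layer symbol, leaving the square of the trace symbol times
  \<open>r / (1 + r)\<^sup>2\<close>.\<close>

lemma single_layer_symbol_bounds:
  assumes "-1 \<le> x" "x < 1" "d \<le> D" "0 \<le> \<rho>" "\<rho> \<le> 1"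
  shows "(1 / 6) ^ (2 * (D + 1)) / 24 \<le> (2 - 2 * x) * (trace_symbol d \<rho> x * layer_symbol x)\<^sup>2"
    and "(2 - 2 * x) * (trace_symbol d \<rho> x * layer_symbol x)\<^sup>2 \<le> 1"
proof -
  define r where "r = decay x"
  define g where "g = trace_symbol d \<rho> x"
  have r: "0 < r" "r < 1" "1 / 6 \<le> r" and quad: "r\<^sup>2 + 1 = (4 - 2 * x) * r"
    using decay_props[OF assms(1,2)] by (auto simp: r_def)
  have x: "2 - 2 * x = (1 - r)\<^sup>2 / r"
    using quad r by (simp add: field_simps power2_eq_square)
  have s: "layer_symbol x = r / ((1 - r) * (1 + r))"
    by (simp add: layer_symbol_def r_def power2_eq_square algebra_simps)
  have eq: "(2 - 2 * x) * (g * layer_symbol x)\<^sup>2 = g\<^sup>2 * (r / (1 + r)\<^sup>2)"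
    unfolding x s using r by (simp add: power_mult_distrib power_divide power2_eq_square)
  have g: "(1 / 6) ^ (D + 1) \<le> g" "g \<le> 1" using trace_symbol_bounds[OF assms] by (auto simp: g_def)
  then have g0: "0 \<le> g" by (meson order_trans zero_le_power zero_le_divide_1_iff zero_le_numeral)
  \<comment> \<open>Numerator at least 1/6, denominator at most 4.\<close>
  have lower: "1 / 24 \<le> r / (1 + r)\<^sup>2"
  proof -
    have "(1 + r)\<^sup>2 \<le> 2\<^sup>2" using r by (intro power_mono) auto
    then show ?thesis using r frac_le[of r "1 / 6" "(1 + r)\<^sup>2" 4] by simp
  qed
  have upper: "r / (1 + r)\<^sup>2 \<le> 1" using r by (simp add: divide_le_eq power2_eq_square algebra_simps)
  have "((1 / 6) ^ (D + 1))\<^sup>2 * (1 / 24) \<le> g\<^sup>2 * (r / (1 + r)\<^sup>2)"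
    using g lower by (intro mult_mono power_mono) auto
  then show "(1 / 6) ^ (2 * (D + 1)) / 24 \<le> (2 - 2 * x) * (trace_symbol d \<rho> x * layer_symbol x)\<^sup>2"
    unfolding eq[unfolded g_def] g_def power_even_eq by linarith
  have "g\<^sup>2 * (r / (1 + r)\<^sup>2) \<le> 1 * 1"
    using g g0 r upper by (intro mult_mono) (auto simp: power_le_one)
  then show "(2 - 2 * x) * (trace_symbol d \<rho> x * layer_symbol x)\<^sup>2 \<le> 1"
    unfolding eq[unfolded g_def] g_def by simp
qed

text \<open>The additional square equals \<open>decay x * (2 - 2 * x)\<close>, so 144 is 24 times
  the 6 from \<open>decay x\<close>. The factor \<open>2 - 2 * x\<close> stays, since it degenerates
  at low frequency.\<close>

lemma double_layer_symbol_bounds: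
  assumes "-1 \<le> x" "x < 1" "d \<le> D" "0 \<le> \<rho>" "\<rho> \<le> 1"
  shows "(1 / 6) ^ (2 * (D + 1)) / 144 * (2 - 2 * x)
      \<le> (2 - 2 * x) * (trace_symbol d \<rho> x * ((decay x - 1) * layer_symbol x))\<^sup>2"
    and "(2 - 2 * x) * (trace_symbol d \<rho> x * ((decay x - 1) * layer_symbol x))\<^sup>2 \<le> 2 - 2 * x"
proof -
  let ?S = "(2 - 2 * x) * (trace_symbol d \<rho> x * layer_symbol x)\<^sup>2"
  note S = single_layer_symbol_bounds[OF assms]
  note r = decay_props[OF assms(1,2)]
  have "(2 - 2 * x) * (trace_symbol d \<rho> x * ((decay x - 1) * layer_symbol x))\<^sup>2 = ?S * (decay x - 1)\<^sup>2"
    by (simp add: power_mult_distrib)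
  also have "(decay x - 1)\<^sup>2 = (2 - 2 * x) * decay x"
    using r(3) by (simp add: power2_eq_square algebra_simps)
  finally have eq: "(2 - 2 * x) * (trace_symbol d \<rho> x * ((decay x - 1) * layer_symbol x))\<^sup>2
      = ?S * decay x * (2 - 2 * x)" by (simp only: mult_ac)
  have "(1 / 6) ^ (2 * (D + 1)) / 24 * (1 / 6) \<le> ?S * decay x"
    using S r assms by (intro mult_mono) auto
  then have "(1 / 6) ^ (2 * (D + 1)) / 24 * (1 / 6) * (2 - 2 * x) \<le> ?S * decay x * (2 - 2 * x)"
    using assms by (intro mult_right_mono) auto
  then show "(1 / 6) ^ (2 * (D + 1)) / 144 * (2 - 2 * x)
      \<le> (2 - 2 * x) * (trace_symbol d \<rho> x * ((decay x - 1) * layer_symbol x))\<^sup>2"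
    unfolding eq by simp
  have "?S * decay x \<le> 1 * 1" using S r assms by (intro mult_mono) auto
  then have "?S * decay x * (2 - 2 * x) \<le> 1 * (2 - 2 * x)"
    using assms by (intro mult_right_mono) auto
  then show "(2 - 2 * x) * (trace_symbol d \<rho> x * ((decay x - 1) * layer_symbol x))\<^sup>2 \<le> 2 - 2 * x"
    unfolding eq by simp
qed

section \<open>Spread of the frequencies\<close>

lemma sin_ge_half:
  assumes "0 \<le> y" "y \<le> pi / 2"
  shows "y / 2 \<le> sin y"
proof -
  have "\<bar>sin y - y\<bar> \<le> y * (y * y) / 6"
    using Maclaurin_sin_bound[of y 3] assms(1) by (simp add: eval_nat_numeral sin_coeff_def)
  \<comment> \<open>17/10 exceeds pi/2, and its square is below 3, so the cubic remainder is at most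
    half of \<open>y\<close>.\<close>
  moreover have "y \<le> 17 / 10" using assms(2) pi_approx(2) by simp
  then have "y * (y * y) \<le> y * (17 / 10 * (17 / 10))"
    using assms(1) by (intro mult_left_mono mult_mono) auto
  ultimately show ?thesis
    using assms(1) by linarith
qed

lemma sin_ge_min:
  assumes "0 \<le> y" "y \<le> pi"
  shows "min y (pi - y) / 2 \<le> sin y"
  using sin_ge_half[of y] sin_ge_half[of "pi - y"] assms by (cases "y \<le> pi / 2") auto

text \<open>All three follow from
  \<open>2 - 2 * cos \<theta> = 4 * (sin (\<theta> / 2))\<^sup>2\<close>: the lower bound at every
  frequency, smallness at the lowest one, and a frequency near pi without degeneration.\<close>

lemma cos_freq_spread:
  assumes "2 \<le> M"
  shows "\<And>k. 0 < k \<Longrightarrow> k < M \<Longrightarrow> 4 / (real M)\<^sup>2 \<le> 2 - 2 * cos (freq M k)"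
    and "2 - 2 * cos (freq M 1) \<le> 64 / (real M)\<^sup>2"
    and "1 \<le> 2 - 2 * cos (freq M (M div 2))"
proof -
  have M: "real M > 0" using assms by simp
  have eq: "2 - 2 * cos (freq M k) = 4 * (sin (pi * real k / real M))\<^sup>2" for k
    by (simp add: cos_freq_eq)
  have lower: "min (pi * real k / real M) (pi - pi * real k / real M) / 2 \<le> sin (pi * real k / real M)"
    if "k \<le> M" for k
    using M that by (intro sin_ge_min) (auto simp: field_simps)
  show "4 / (real M)\<^sup>2 \<le> 2 - 2 * cos (freq M k)" if k: "0 < k" "k < M" for k
  proof -
    have "2 * 1 \<le> pi * real k" "2 * 1 \<le> pi * real (M - k)"
      using k pi_ge_two by (intro mult_mono; simp)+
    then have "2 / real M \<le> pi * real k / real M" "2 / real M \<le> pi - pi * real k / real M"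
      using M k by (auto simp: field_simps of_nat_diff)
    then have "1 / real M \<le> sin (pi * real k / real M)"
      using lower[of k] k by simp
    then have "(1 / real M)\<^sup>2 \<le> (sin (pi * real k / real M))\<^sup>2"
      using M by (intro power_mono) auto
    then show ?thesis unfolding eq by (simp add: power_divide)
  qed
  have "\<bar>sin (pi / real M)\<bar> \<le> \<bar>pi / real M\<bar>" by (rule abs_sin_x_le_abs_x)
  also have "\<dots> \<le> 4 / real M" using M pi_less_4 by (simp add: divide_right_mono)
  finally have "\<bar>sin (pi / real M)\<bar>\<^sup>2 \<le> (4 / real M)\<^sup>2" by (intro power_mono) auto
  then show "2 - 2 * cos (freq M 1) \<le> 64 / (real M)\<^sup>2"
    unfolding eq by (simp add: power_divide)
  \<comment> \<open>The worst case is \<open>M = 3\<close>; the half angle thus lies between pi/3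
    and pi/2.\<close>
  have "M \<le> 3 * (M div 2)" "2 * (M div 2) \<le> M" using assms by linarith+
  then have k: "real M \<le> 3 * real (M div 2)" "2 * real (M div 2) \<le> real M" by linarith+
  have "1 * real M \<le> pi * real (M div 2)"
  proof -
    have "3 * real (M div 2) \<le> pi * real (M div 2)" using pi_gt3 by (intro mult_right_mono) auto
    then show ?thesis using k by linarith
  qed
  then have "1 \<le> pi * real (M div 2) / real M" using M by (simp add: field_simps)
  moreover have "1 \<le> pi - pi * real (M div 2) / real M"
  proof -
    have "pi * (2 * real (M div 2)) \<le> pi * real M" using k by (intro mult_left_mono) auto
    then have "pi * real (M div 2) / real M \<le> pi / 2" using M by (simp add: field_simps)
    then show ?thesis using pi_gt3 by linarith
  qed
  ultimately have "1 / 2 \<le> sin (pi * real (M div 2) / real M)"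
    using lower[of "M div 2"] by simp
  then have "(1 / 2)\<^sup>2 \<le> (sin (pi * real (M div 2) / real M))\<^sup>2" by (intro power_mono) auto
  then show "1 \<le> 2 - 2 * cos (freq M (M div 2))" unfolding eq by (simp add: power_divide)
qed

section \<open>Extreme eigenvalues and assembly of the constants\<close>

lemma comparableI:
  assumes "0 \<le> b" "l * b \<le> a" "a \<le> u * b" "u \<le> c" "0 < l" "1 / l \<le> c"
  shows "comparable c a b"
proof -
  have "0 < 1 / l" using assms by simp
  then have "0 < c" using assms by linarith
  then have "inverse c \<le> l" using assms by (simp add: field_simps)
  then show ?thesis
    using assms mult_right_mono[of "inverse c" l b] mult_right_mono[of u c b]
    unfolding comparable_def by linarith
qed

lemma eigenvalue_bounds_single_layer:
  assumes "2 \<le> M" "h > 0" "d \<le> D" "0 \<le> \<rho>" "\<rho> \<le> 1"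
  defines "a \<equiv> (1 / 6) ^ (2 * (D + 1)) / 144"
    and "K \<equiv> density_stiffness M h d \<rho> (single_layer M)"
  shows "a / h \<le> lambda_min M K" "lambda_min M K \<le> lambda_max M K" "lambda_max M K \<le> 1 / h"
proof -
  have M: "M > 0" using assms(1) by simp
  let ?S = "eigenvalues M K"
  have S: "?S = (\<lambda>k. (2 - 2 * cos (freq M k))
      * (trace_symbol d \<rho> (cos (freq M k)) * layer_symbol (cos (freq M k)))\<^sup>2 / h) ` {1..<M}"
    unfolding K_def by (intro eigenvalues_density_stiffness M assms single_layer_fourier_multiplier)
  \<comment> \<open>Nonemptiness comes from \<open>2 \<le> M\<close>, which provides
    \<open>k = 1\<close>.\<close>
  have fin: "finite ?S" "?S \<noteq> {}" unfolding S using assms(1) by auto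
  have "a / h \<le> \<mu> \<and> \<mu> \<le> 1 / h" if mem: "\<mu> \<in> ?S" for \<mu>
  proof -
    obtain k where k: "k \<in> {1..<M}" and \<mu>: "\<mu> = (2 - 2 * cos (freq M k))
      * (trace_symbol d \<rho> (cos (freq M k)) * layer_symbol (cos (freq M k)))\<^sup>2 / h"
      using mem unfolding S by blast
    then have k: "0 < k" "k < M" by auto
    note b = single_layer_symbol_bounds[OF cos_ge_minus_one cos_freq_less_1[OF k] assms(3-5)]
    have "0 \<le> (1 / 6 :: real) ^ (2 * (D + 1))" by simp
    \<comment> \<open>The smaller constant with 144 in place of 24 is shared with the double
      layer.\<close>
    then have "a \<le> (1 / 6) ^ (2 * (D + 1)) / 24" unfolding a_def by linarith
    then show ?thesis
      unfolding \<mu> using b assms(2) by (intro conjI divide_right_mono) linarith+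
  qed
  then show "a / h \<le> lambda_min M K" "lambda_max M K \<le> 1 / h"
    unfolding lambda_min_def lambda_max_def using fin by auto
  show "lambda_min M K \<le> lambda_max M K"
    unfolding lambda_min_def lambda_max_def using fin Min_in by (intro Max_ge) auto
qed

text \<open>The outer bounds hold for every eigenvalue; the inner ones sample the frequency
  \<open>k = 1\<close> for the minimum and \<open>k = M div 2\<close> for the maximum.\<close>

lemma eigenvalue_bounds_double_layer:
  assumes "2 \<le> M" "h > 0" "d \<le> D" "0 \<le> \<rho>" "\<rho> \<le> 1"
  defines "a \<equiv> (1 / 6) ^ (2 * (D + 1)) / 144"
    and "K \<equiv> density_stiffness M h d \<rho> (double_layer M)"
  shows "a * 4 / (real M)\<^sup>2 / h \<le> lambda_min M K" "lambda_min M K \<le> 64 / (real M)\<^sup>2 / h"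
    and "a / h \<le> lambda_max M K" "lambda_max M K \<le> 4 / h"
proof -
  have M: "M > 0" using assms(1) by simp
  define f where "f k = (2 - 2 * cos (freq M k)) * (trace_symbol d \<rho> (cos (freq M k))
      * ((decay (cos (freq M k)) - 1) * layer_symbol (cos (freq M k))))\<^sup>2" for k
  let ?S = "eigenvalues M K"
  have "?S = (\<lambda>k. (2 - 2 * cos (freq M k)) * (trace_symbol d \<rho> (cos (freq M k))
      * ((decay (cos (freq M k)) - 1) * layer_symbol (cos (freq M k))))\<^sup>2 / h) ` {1..<M}"
    unfolding K_def by (intro eigenvalues_density_stiffness M assms double_layer_fourier_multiplier)
  then have S: "?S = (\<lambda>k. f k / h) ` {1..<M}" unfolding f_def .
  have fin: "finite ?S" "?S \<noteq> {}" unfolding S using assms(1) by auto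
  have b: "a * (2 - 2 * cos (freq M k)) \<le> f k" "f k \<le> 2 - 2 * cos (freq M k)" if k: "0 < k" "k < M" for k
    using double_layer_symbol_bounds[OF cos_ge_minus_one cos_freq_less_1[OF k] assms(3-5)]
    unfolding f_def a_def by auto
  have a: "0 \<le> a" by (simp add: a_def)
  have "a * 4 / (real M)\<^sup>2 / h \<le> \<mu> \<and> \<mu> \<le> 4 / h" if mem: "\<mu> \<in> ?S" for \<mu>
  proof -
    obtain k where k: "k \<in> {1..<M}" and \<mu>: "\<mu> = f k / h"
      using mem unfolding S by blast
    then have k: "0 < k" "k < M" by auto
    have "a * (4 / (real M)\<^sup>2) \<le> a * (2 - 2 * cos (freq M k))"
      by (intro mult_left_mono cos_freq_spread(1) assms(1) k a)
    then have "a * 4 / (real M)\<^sup>2 \<le> f k" using b(1)[OF k] by simp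
    moreover have "f k \<le> 4" using b(2)[OF k] cos_ge_minus_one[of "freq M k"] by linarith
    ultimately show ?thesis
      unfolding \<mu> using assms(2) by (intro conjI divide_right_mono) linarith+
  qed
  then show "a * 4 / (real M)\<^sup>2 / h \<le> lambda_min M K" "lambda_max M K \<le> 4 / h"
    unfolding lambda_min_def lambda_max_def using fin by auto
  have "lambda_min M K \<le> f 1 / h"
    unfolding lambda_min_def using fin(1) assms(1) by (intro Min_le) (auto simp: S)
  also have "f 1 \<le> 64 / (real M)\<^sup>2"
    using b(2)[of 1] cos_freq_spread(2)[OF assms(1)] assms(1) by simp
  finally show "lambda_min M K \<le> 64 / (real M)\<^sup>2 / h"
    using assms(2) by (simp add: divide_right_mono)
  have k: "0 < M div 2" "M div 2 < M" using assms(1) by auto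
  have "a * 1 \<le> a * (2 - 2 * cos (freq M (M div 2)))"
    by (intro mult_left_mono cos_freq_spread(3) assms(1) a)
  then have "a / h \<le> f (M div 2) / h"
    using b(1)[OF k] assms(2) by (intro divide_right_mono) linarith+
  also have "\<dots> \<le> lambda_max M K"
    unfolding lambda_max_def using fin(1) k by (intro Max_ge) (auto simp: S)
  finally show "a / h \<le> lambda_max M K" .
qed

theorem theorem34:
  fixes L :: real and D :: nat
  assumes "L > 0"
  shows "\<exists>c>0. \<forall>M::nat. \<forall>h::real. \<forall>d::nat. \<forall>\<rho>::real.
    2 \<le> M \<longrightarrow> real M * h = L \<longrightarrow> d \<le> D \<longrightarrow> 0 \<le> \<rho> \<longrightarrow> \<rho> \<le> 1 \<longrightarrow>
    (let KS = density_stiffness M h d \<rho> (single_layer M);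
         KD = density_stiffness M h d \<rho> (double_layer M)
     in comparable c (lambda_min M KS) (lambda_max M KS) \<and>
        comparable c (lambda_min M KS) (1 / h) \<and>
        comparable c (lambda_max M KS) (1 / h) \<and>
        comparable c (lambda_min M KD) h \<and>
        comparable c (lambda_max M KD) (1 / h) \<and>
        condition_number M KS \<le> c \<and>
        condition_number M KD \<le> c * (1 / h\<^sup>2))"
proof -
  define a :: real where "a = (1 / 6) ^ (2 * (D + 1)) / 144"
  \<comment> \<open>A sum of positive terms dominates each: \<open>1 / a\<close> inverts the lower
    constants, the terms with \<open>L\<close> come from the smallest double-layer eigenvalue and
    its condition number, and 4 bounds its largest eigenvalue.\<close>
  define c where "c = 1 / a + L\<^sup>2 / a + 64 / L\<^sup>2 + 4"
  have a: "0 < a" by (simp add: a_def)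
  have parts: "0 < 1 / a" "0 < L\<^sup>2 / a" "0 < 64 / L\<^sup>2" using a assms by auto
  then have c: "0 < c" "1 / a \<le> c" "L\<^sup>2 / a \<le> c" "64 / L\<^sup>2 \<le> c" "4 \<le> c" "1 \<le> c"
    unfolding c_def by linarith+
  show ?thesis
  proof (intro exI[of _ c] conjI allI impI, fact c(1))
    fix M :: nat and h :: real and d :: nat and \<rho> :: real
    assume hyps: "2 \<le> M" "real M * h = L" "d \<le> D" "0 \<le> \<rho>" "\<rho> \<le> 1"
    then have M: "real M > 0" by simp
    then have h: "0 < h" using hyps(2) assms by (metis zero_less_mult_pos)
    \<comment> \<open>With \<open>M * h = L\<close> fixed, order \<open>1 / (M\<^sup>2 * h)\<close>
      becomes order \<open>h\<close>.\<close>
    have inv: "x / (real M)\<^sup>2 / h = x / L\<^sup>2 * h" for x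
      unfolding hyps(2)[symmetric] using M h by (simp add: field_simps power2_eq_square)
    define KS where "KS = density_stiffness M h d \<rho> (single_layer M)"
    define KD where "KD = density_stiffness M h d \<rho> (double_layer M)"
    note S = eigenvalue_bounds_single_layer[OF hyps(1) h hyps(3-5), folded a_def KS_def]
    note D = eigenvalue_bounds_double_layer[OF hyps(1) h hyps(3-5), folded a_def KD_def, unfolded inv]
    have Smin: "0 < lambda_min M KS"
      using S(1) a h by (meson divide_pos_pos less_le_trans)
    have "0 < a * 4 / L\<^sup>2 * h" using a h assms by simp
    have "a * lambda_max M KS \<le> a / h"
      using mult_left_mono[OF S(3), of a] a by simp
    \<comment> \<open>Both are compared with \<open>a / h\<close>.\<close>
    then have ratio: "a * lambda_max M KS \<le> lambda_min M KS" using S(1) by linarith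
    have "comparable c (lambda_min M KS) (lambda_max M KS)"
      by (rule comparableI[of _ a _ 1]) (use ratio S Smin a c in auto)
    moreover have "comparable c (lambda_min M KS) (1 / h)" "comparable c (lambda_max M KS) (1 / h)"
      by (rule comparableI[of _ a _ 1]; use S a c h in auto)+
    moreover have "comparable c (lambda_min M KD) h"
    proof (rule comparableI[OF _ D(1,2)])
      have eq: "1 / (a * 4 / L\<^sup>2) = (L\<^sup>2 / a) / 4" by simp
      have "(L\<^sup>2 / a) / 4 \<le> L\<^sup>2 / a" using parts(2) by simp
      then show "1 / (a * 4 / L\<^sup>2) \<le> c" unfolding eq using c(3) by (rule order_trans)
    qed (use a c h assms in auto)
    moreover have "comparable c (lambda_max M KD) (1 / h)"
      by (rule comparableI[of _ a _ 4]) (use D a c h in auto)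
    moreover have "condition_number M KS \<le> c"
    proof -
      have "condition_number M KS \<le> 1 / a"
        unfolding condition_number_def using ratio Smin a by (simp add: field_simps)
      then show ?thesis using c by linarith
    qed
    moreover have "condition_number M KD \<le> c * (1 / h\<^sup>2)"
    proof -
      have "condition_number M KD \<le> (4 / h) / (a * 4 / L\<^sup>2 * h)"
        unfolding condition_number_def
        using D(4,1) h \<open>0 < a * 4 / L\<^sup>2 * h\<close> by (intro frac_le) auto
      also have "\<dots> = L\<^sup>2 / a * (1 / h\<^sup>2)"
        using h a assms by (simp add: field_simps power2_eq_square)
      also have "\<dots> \<le> c * (1 / h\<^sup>2)" using c by (intro mult_right_mono) auto
      finally show ?thesis .
    qed
    ultimately show "let KS = density_stiffness M h d \<rho> (single_layer M);
         KD = density_stiffness M h d \<rho> (double_layer M)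
     in comparable c (lambda_min M KS) (lambda_max M KS) \<and>
        comparable c (lambda_min M KS) (1 / h) \<and>
        comparable c (lambda_max M KS) (1 / h) \<and>
        comparable c (lambda_min M KD) h \<and>
        comparable c (lambda_max M KD) (1 / h) \<and>
        condition_number M KS \<le> c \<and>
        condition_number M KD \<le> c * (1 / h\<^sup>2)"
      unfolding Let_def KS_def KD_def by blast
  qed
qed

end
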